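(* Let $\mu$ be a Borel probability measure on $\widetilde G(\mathbb R^d)$ with infinite radius of convergence, i.e. $$\sum_{k=0}^\infty \lambda^k \,\big\| \mathbb E_{S\sim \mu}\, S^k \big\|_{(\mathbb R^d)^{\otimes k}} < \infty \quad \text{for all } \lambda>0 .$$ Then the space of linear coordinate functions on $\widetilde G(\mathbb R^d)$, i.e. the linear span of the functions $S \mapsto \langle w, S\rangle$ with $w$ ranging over all words in the alphabet $\{1,\dots,d\}$ (including the empty word), is dense in $L^p(\mu)$ for all $p\in[1,\infty)$.
   Context: $T((\mathbb R^d)) = \prod_{k\ge 0} (\mathbb R^d)^{\otimes k}$; its elements are written $S=(S^0,S^1,S^2,\dots)$. For a word $w=\alpha_1\dots\alpha_k$ in $\{1,\dots,d\}$, $\langle w,S\rangle$ is the coefficient of $e_{\alpha_1}\otimes\cdots\otimes e_{\alpha_k}$ in $S^k$ (for the empty word it is $S^0$), extended linearly to formal linear combinations of words. $G(\mathbb R^d)\subset T((\mathbb R^d))$ is the group of group-like elements: those $S$ with $S^0=1$ and $\langle u,S\rangle\langle v,S\rangle=\langle u\sqcup\!\sqcup v,S\rangle$ for all words $u,v$, where $\sqcup\!\sqcup$ is the shuffle product. $\mathbb R^d$ is equipped with the $\ell^1$ norm and $(\mathbb R^d)^{\otimes k}$ with the projective tensor norm. $\widetilde G(\mathbb R^d)$ is the set of $S\in G(\mathbb R^d)$ with $\|S\|_\lambda:=\sum_{k\ge0}\lambda^k\|S^k\|_{(\mathbb R^d)^{\otimes k}}<\infty$ for every $\lambda>0$, equipped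 with the topology induced by the norms $\|\cdot\|_\lambda$, $\lambda>0$ (it is a Polish space). It is implicit in the hypothesis that each $S^k$ is $\mu$-integrable, so that $\mathbb E_{S\sim\mu}S^k$ is defined. *)

theory Defs
  imports "HOL-Probability.Probability" "HOL-Library.Multiset"
begin

text \<open>
  The alphabet is a finite type 'd, so a word is a list over 'd and d = CARD('d).
  An element S of T((R^d)) is given by its coefficients: S w is the pairing of the word w with S.
  A tensor of degree k is likewise a coefficient function, vanishing on words of length other
  than k.
\<close>

type_synonym 'd tensor_series = "'d list \<Rightarrow> real"

definition level :: "nat \<Rightarrow> 'd tensor_series \<Rightarrow> 'd tensor_series" where
  "level k S = (\<lambda>w. if length w = k then S w else 0)"

definition l1_norm :: "real ^ 'd::finite \<Rightarrow> real" where
  "l1_norm v = (\<Sum>a\<in>UNIV. \<bar>v $ a\<bar>)"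

definition elementary_tensor :: "nat \<Rightarrow> (nat \<Rightarrow> real ^ 'd::finite) \<Rightarrow> 'd tensor_series" where
  "elementary_tensor k v = level k (\<lambda>w. \<Prod>j<k. v j $ (w ! j))"

text \<open>
  The scalars c i are redundant for k > 0; for k = 0, where the only elementary tensor
  is the unit, they are what makes this the absolute value on R.
\<close>

definition projective_norm :: "nat \<Rightarrow> 'd::finite tensor_series \<Rightarrow> real" where
  "projective_norm k t =
     Inf {(\<Sum>i<n. \<bar>c i\<bar> * (\<Prod>j<k. l1_norm (v i j))) | (n :: nat) (c :: nat \<Rightarrow> real)
            (v :: nat \<Rightarrow> nat \<Rightarrow> real ^ 'd).
            t = (\<lambda>w. \<Sum>i<n. c i * elementary_tensor k (v i) w)}"

text \<open>
  Shuffles are counted with multiplicity, so the library's set-valued shuffles does not suffice;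
  the multiset stands for the corresponding formal sum of words.
\<close>

fun shuffle_product :: "'a list \<Rightarrow> 'a list \<Rightarrow> 'a list multiset" where
  "shuffle_product [] v = {#v#}"
| "shuffle_product (a # u) [] = {#a # u#}"
| "shuffle_product (a # u) (b # v) =
     image_mset (Cons a) (shuffle_product u (b # v)) +
     image_mset (Cons b) (shuffle_product (a # u) v)"

definition group_like :: "'d tensor_series set" where
  "group_like = {S. S [] = 1 \<and> (\<forall>u v. S u * S v = (\<Sum>w\<in>#shuffle_product u v. S w))}"

text \<open>
  The real-valued series below is only meaningful where it converges; this is the case for the
  elements of \<open>group_like_fin\<close> and their differences.
\<close>

definition weighted_norm :: "real \<Rightarrow> 'd::finite tensor_series \<Rightarrow> real" where
  "weighted_norm l S = (\<Sum>k. l ^ k * projective_norm k (level k S))"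

definition group_like_fin :: "'d::finite tensor_series set" where
  "group_like_fin =
     {S \<in> group_like. \<forall>l>0. summable (\<lambda>k. l ^ k * projective_norm k (level k S))}"

definition group_like_fin_topology :: "'d::finite tensor_series topology" where
  "group_like_fin_topology = topology_generated_by
     {{T \<in> group_like_fin. weighted_norm l (\<lambda>w. T w - S w) < r} | S l r.
        S \<in> group_like_fin \<and> l > 0 \<and> r > 0}"

definition group_like_fin_borel :: "'d::finite tensor_series measure" where
  "group_like_fin_borel = sigma group_like_fin {U. openin group_like_fin_topology U}"

text \<open>The expectation in the finite-dimensional space of degree-k tensors is coordinatewise.\<close>

definition integrable_levels :: "'d tensor_series measure \<Rightarrow> bool" where
  "integrable_levels M \<longleftrightarrow> (\<forall>w. integrable M (\<lambda>S. S w))"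

definition expected_level :: "'d tensor_series measure \<Rightarrow> nat \<Rightarrow> 'd tensor_series" where
  "expected_level M k = (\<lambda>w. LINT S|M. level k S w)"

definition infinite_radius_of_convergence :: "'d::finite tensor_series measure \<Rightarrow> bool" where
  "infinite_radius_of_convergence M \<longleftrightarrow>
     (\<forall>l>0. summable (\<lambda>k. l ^ k * projective_norm k (expected_level M k)))"

definition linear_coordinate_functions :: "('d tensor_series \<Rightarrow> real) set" where
  "linear_coordinate_functions =
     {(\<lambda>S. \<Sum>w\<in>W. c w * S w) | (W :: 'd list set) (c :: 'd list \<Rightarrow> real). finite W}"

text \<open>L^p is represented by functions rather than by their almost-everywhere classes.\<close>

definition Lp_space :: "real \<Rightarrow> 'a measure \<Rightarrow> ('a \<Rightarrow> real) set" where
  "Lp_space p M = {f \<in> borel_measurable M. integrable M (\<lambda>x. \<bar>f x\<bar> powr p)}"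

definition Lp_norm :: "real \<Rightarrow> 'a measure \<Rightarrow> ('a \<Rightarrow> real) \<Rightarrow> real" where
  "Lp_norm p M f = (LINT x|M. \<bar>f x\<bar> powr p) powr (1 / p)"

definition dense_in_Lp :: "real \<Rightarrow> 'a measure \<Rightarrow> ('a \<Rightarrow> real) set \<Rightarrow> bool" where
  "dense_in_Lp p M V \<longleftrightarrow>
     V \<subseteq> Lp_space p M \<and>
     (\<forall>f\<in>Lp_space p M. \<forall>e>0. \<exists>g\<in>V. Lp_norm p M (\<lambda>x. f x - g x) < e)"

end

theory Submission
  imports Defs
begin

text \<open>
Let \<open>L\<close> be the span of the coordinates. By the shuffle identity it is an algebra of functions on the
group-like elements, and it consists of integrable functions. Call a bounded measurable function
approximable if it is an \<open>L^q\<close> limit of members of \<open>L\<close> for every even integer \<open>q\<close>. Approximable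
functions form an algebra that is closed under bounded pointwise limits
(\<open>approximable_mult\<close>, \<open>approximable_bounded_limit\<close>). By Weierstrass' theorem it is also closed under
composition with continuous functions. Hence the events with approximable indicator form a
sigma-algebra for which every approximable function is measurable
(\<open>sigma_algebra_approximable_events\<close>, \<open>approximable_measurable\<close>). If this sigma-algebra contains
every event, then simple functions are approximable and \<open>L\<close> is dense in every \<open>L^p\<close> (\<open>dense_powr\<close>). As the
Borel sigma-algebra is generated by the coordinates (\<open>sets_group_like_fin_borel_subset\<close>), it remains to
express each coordinate as a pointwise limit of approximable functions.

These functions come from orthogonal representations. If the letters are mapped to skew-symmetric
matrices, a group-like element is mapped to an orthogonal matrix, whose entries are bounded by one
(\<open>sum_zigzag_coordinate_squares\<close>). An entry is an infinite series of coordinates with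
exponentially growing coefficients. It converges in every \<open>L^q\<close>: a power of a coordinate is a sum
of coordinates of higher degree, so the infinite radius of convergence forces the \<open>q\<close>-th moment of the
coordinates to decay superexponentially in the degree (\<open>coordinate_moment_bound\<close>,
\<open>approximable_word_series\<close>). Finally, given a word \<open>w\<close> of length \<open>k\<close>, tridiagonal matrices of
size \<open>k + 1\<close> can be chosen so that no word of length at most \<open>k\<close> other than \<open>w\<close> contributes to the corner
entry. Scaling the matrices by \<open>t\<close>, dividing the corner entry by \<open>t ^ k\<close> and letting \<open>t\<close> tend to zero
recovers the coordinate \<open>w\<close> (\<open>zigzag_coordinate_limit\<close>).
\<close>


section \<open>Closures of function algebras in all moments\<close>

lemma even_power_add_le:
  fixes a b :: real
  shows "(a + b) ^ (2 * n) \<le> 4 ^ n * (a ^ (2 * n) + b ^ (2 * n))"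
proof -
  have "\<bar>a + b\<bar> \<le> 2 * max \<bar>a\<bar> \<bar>b\<bar>" by linarith
  then have "\<bar>a + b\<bar> ^ (2 * n) \<le> (2 * max \<bar>a\<bar> \<bar>b\<bar>) ^ (2 * n)"
    by (intro power_mono) auto
  also have "\<dots> = 4 ^ n * max \<bar>a\<bar> \<bar>b\<bar> ^ (2 * n)"
    by (simp add: power_mult_distrib power_mult)
  also have "\<dots> \<le> 4 ^ n * (a ^ (2 * n) + b ^ (2 * n))"
    by (intro mult_left_mono) (auto simp: max_def power_even_abs)
  finally show ?thesis by (simp add: power_even_abs)
qed

lemma powr_add_le:
  fixes a b p :: real
  assumes "p \<ge> 0"
  shows "\<bar>a + b\<bar> powr p \<le> 2 powr p * (\<bar>a\<bar> powr p + \<bar>b\<bar> powr p)"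
proof -
  have "\<bar>a + b\<bar> powr p \<le> (2 * max \<bar>a\<bar> \<bar>b\<bar>) powr p"
    by (intro powr_mono2) (use assms in auto)
  also have "\<dots> = 2 powr p * max \<bar>a\<bar> \<bar>b\<bar> powr p" by (rule powr_mult)
  also have "\<dots> \<le> 2 powr p * (\<bar>a\<bar> powr p + \<bar>b\<bar> powr p)"
    by (intro mult_left_mono) (auto simp: max_def)
  finally show ?thesis .
qed

text \<open>
This is how even integer exponents, for which norms are integrals of polynomials, control
arbitrary real exponents \<open>p\<close>.
\<close>

lemma powr_le_even_power:
  fixes x p d :: real
  assumes "p \<ge> 0" "p \<le> 2 * n" "d > 0"
  shows "\<bar>x\<bar> powr p \<le> d powr p + d powr (p - 2 * n) * x ^ (2 * n)"
proof (cases "\<bar>x\<bar> \<le> d")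
  case True
  then have "\<bar>x\<bar> powr p \<le> d powr p" using assms by (intro powr_mono2) auto
  then show ?thesis by (intro order_trans[OF _ add_increasing2]) auto
next
  case False
  then have x: "\<bar>x\<bar> > 0" using assms by simp
  have "\<bar>x\<bar> powr p = \<bar>x\<bar> powr (p - 2 * n) * \<bar>x\<bar> powr real (2 * n)"
    by (simp add: powr_add[symmetric])
  also have "\<bar>x\<bar> powr real (2 * n) = x ^ (2 * n)"
    using x by (subst powr_realpow) (auto simp: power_even_abs)
  also have "\<bar>x\<bar> powr (p - 2 * n) * x ^ (2 * n) \<le> d powr (p - 2 * n) * x ^ (2 * n)"
    using False assms by (intro mult_right_mono powr_mono2') auto
  also have "\<dots> \<le> d powr p + d powr (p - 2 * n) * x ^ (2 * n)" by simp
  finally show ?thesis by simp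
qed

text \<open>
An algebra of functions on a probability space all of whose members are integrable. Being closed
under products, it then consists of functions with finite moments of every order.
\<close>

locale integrable_function_algebra = prob_space M for M :: "'a measure" +
  fixes L :: "('a \<Rightarrow> real) set"
  assumes const_mem: "(\<lambda>_. c) \<in> L"
    and add_mem: "f \<in> L \<Longrightarrow> g \<in> L \<Longrightarrow> (\<lambda>x. f x + g x) \<in> L"
    and mult_mem: "f \<in> L \<Longrightarrow> g \<in> L \<Longrightarrow> (\<lambda>x. f x * g x) \<in> L"
    and integrable_mem: "f \<in> L \<Longrightarrow> integrable M f"
begin

lemma power_mem: "f \<in> L \<Longrightarrow> (\<lambda>x. f x ^ n) \<in> L"
  by (induction n) (auto simp: const_mem mult_mem)

lemma measurable_mem [measurable_dest]: "f \<in> L \<Longrightarrow> f \<in> borel_measurable M"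
  by (rule borel_measurable_integrable[OF integrable_mem])

lemma integrable_power_mem: "f \<in> L \<Longrightarrow> integrable M (\<lambda>x. f x ^ n)"
  by (rule integrable_mem[OF power_mem])

text \<open>
Boundedness is required everywhere on the space, not just almost everywhere.
\<close>

definition bounded_measurable :: "('a \<Rightarrow> real) \<Rightarrow> bool" where
  "bounded_measurable f \<longleftrightarrow> f \<in> borel_measurable M \<and> (\<exists>B. \<forall>x\<in>space M. \<bar>f x\<bar> \<le> B)"

lemma bounded_measurable_measurable [measurable_dest]:
  "bounded_measurable f \<Longrightarrow> f \<in> borel_measurable M"
  by (simp add: bounded_measurable_def)

lemma bounded_measurable_bound:
  assumes "bounded_measurable f"
  obtains B where "B > 0" "\<And>x. x \<in> space M \<Longrightarrow> \<bar>f x\<bar> \<le> B"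
proof -
  obtain B where B: "\<forall>x\<in>space M. \<bar>f x\<bar> \<le> B"
    using assms unfolding bounded_measurable_def by blast
  have "\<bar>f x\<bar> \<le> max B 1" if "x \<in> space M" for x
    using bspec[OF B that] by linarith
  then show ?thesis by (intro that[of "max B 1"]) auto
qed

lemma bounded_measurable_power:
  assumes "bounded_measurable f"
  shows "integrable M (\<lambda>x. f x ^ n)"
proof -
  obtain B where B: "B > 0" "\<And>x. x \<in> space M \<Longrightarrow> \<bar>f x\<bar> \<le> B"
    using bounded_measurable_bound[OF assms] by blast
  have [measurable]: "f \<in> borel_measurable M" using assms by (rule bounded_measurable_measurable)
  show ?thesis
    by (rule integrable_const_bound[where B = "B ^ n"])
       (auto intro!: AE_I2 power_mono simp: power_abs B)
qed

lemma bounded_measurable_add: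
  assumes "bounded_measurable f" "bounded_measurable g"
  shows "bounded_measurable (\<lambda>x. f x + g x)"
proof -
  obtain B where B: "\<And>x. x \<in> space M \<Longrightarrow> \<bar>f x\<bar> \<le> B"
    using bounded_measurable_bound[OF assms(1)] by blast
  obtain C where C: "\<And>x. x \<in> space M \<Longrightarrow> \<bar>g x\<bar> \<le> C"
    using bounded_measurable_bound[OF assms(2)] by blast
  have "\<bar>f x + g x\<bar> \<le> B + C" if "x \<in> space M" for x
    using B[OF that] C[OF that] by linarith
  moreover have "(\<lambda>x. f x + g x) \<in> borel_measurable M"
    using assms by (intro borel_measurable_add bounded_measurable_measurable)
  ultimately show ?thesis unfolding bounded_measurable_def by blast
qed

lemma bounded_measurable_mult:
  assumes "bounded_measurable f" "bounded_measurable g"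
  shows "bounded_measurable (\<lambda>x. f x * g x)"
proof -
  obtain B where B: "B > 0" "\<And>x. x \<in> space M \<Longrightarrow> \<bar>f x\<bar> \<le> B"
    using bounded_measurable_bound[OF assms(1)] by blast
  obtain C where C: "\<And>x. x \<in> space M \<Longrightarrow> \<bar>g x\<bar> \<le> C"
    using bounded_measurable_bound[OF assms(2)] by blast
  have "\<bar>f x * g x\<bar> \<le> B * C" if "x \<in> space M" for x
    unfolding abs_mult using B C that by (intro mult_mono) auto
  moreover have "(\<lambda>x. f x * g x) \<in> borel_measurable M"
    using assms by (intro borel_measurable_times bounded_measurable_measurable)
  ultimately show ?thesis unfolding bounded_measurable_def by blast
qed

lemma bounded_measurable_const: "bounded_measurable (\<lambda>_. c)"
  by (auto simp: bounded_measurable_def)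

lemma integrable_diff_power:
  assumes "bounded_measurable f" "g \<in> L"
  shows "integrable M (\<lambda>x. (f x - g x) ^ (2 * n))"
proof (rule Bochner_Integration.integrable_bound)
  show "integrable M (\<lambda>x. 4 ^ n * (f x ^ (2 * n) + g x ^ (2 * n)))"
    using assms by (intro integrable_mult_right Bochner_Integration.integrable_add
        bounded_measurable_power integrable_power_mem)
  show "(\<lambda>x. (f x - g x) ^ (2 * n)) \<in> borel_measurable M"
    using assms by measurable
  show "AE x in M. norm ((f x - g x) ^ (2 * n)) \<le> norm (4 ^ n * (f x ^ (2 * n) + g x ^ (2 * n)))"
  proof (rule AE_I2)
    fix x
    show "norm ((f x - g x) ^ (2 * n)) \<le> norm (4 ^ n * (f x ^ (2 * n) + g x ^ (2 * n)))"
      using even_power_add_le[of "f x" "- g x" n] by (simp add: abs_mult)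
  qed
qed

text \<open>
The bounded measurable functions that lie in the \<open>L^q\<close> closure of the algebra for every even
\<open>q = 2 * n\<close>. Asking for all exponents at once is what makes these functions closed under
products: the error of a product is controlled by errors of twice the exponent. The approximant
may depend on the exponent, and is in general unbounded.
\<close>

definition approximable :: "('a \<Rightarrow> real) \<Rightarrow> bool" where
  "approximable f \<longleftrightarrow> bounded_measurable f \<and>
     (\<forall>n>0. \<forall>e>0. \<exists>g\<in>L. (LINT x|M. (f x - g x) ^ (2 * n)) < e)"

lemma approximable_bounded_measurable: "approximable f \<Longrightarrow> bounded_measurable f"
  by (simp add: approximable_def)

lemma approximableD:
  assumes "approximable f" "n > 0" "e > 0"
  obtains g where "g \<in> L" "(LINT x|M. (f x - g x) ^ (2 * n)) < e"
  using assms unfolding approximable_def by blast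

lemma approximable_const: "approximable (\<lambda>_. c)"
  unfolding approximable_def
proof (intro conjI allI impI)
  fix n :: nat and e :: real assume "n > 0" "e > 0"
  then show "\<exists>g\<in>L. (LINT x|M. (c - g x) ^ (2 * n)) < e"
    by (intro bexI[OF _ const_mem[of c]]) (simp add: zero_power)
qed (rule bounded_measurable_const)

lemma approximable_closure:
  assumes f: "bounded_measurable f"
    and h: "\<And>n e. n > 0 \<Longrightarrow> e > 0 \<Longrightarrow>
          \<exists>h. approximable h \<and> (LINT x|M. (f x - h x) ^ (2 * n)) < e"
  shows "approximable f"
  unfolding approximable_def
proof (intro conjI allI impI f)
  fix n :: nat and e :: real assume n: "n > 0" and e: "e > 0"
  define d where "d = e / (2 * 4 ^ n)"
  have d: "d > 0" using e by (simp add: d_def)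
  obtain h where h: "approximable h" "(LINT x|M. (f x - h x) ^ (2 * n)) < d"
    using h[OF n d] by blast
  obtain g where g: "g \<in> L" "(LINT x|M. (h x - g x) ^ (2 * n)) < d"
    using approximableD[OF h(1) n d] by blast
  have hb: "bounded_measurable h" by (rule approximable_bounded_measurable[OF h(1)])
  have fh: "bounded_measurable (\<lambda>x. f x - h x)"
    using bounded_measurable_add[OF f bounded_measurable_mult[OF bounded_measurable_const[of "-1"] hb]]
    by simp
  have i1: "integrable M (\<lambda>x. (f x - h x) ^ (2 * n))"
    by (rule bounded_measurable_power[OF fh])
  have i2: "integrable M (\<lambda>x. (h x - g x) ^ (2 * n))"
    by (rule integrable_diff_power[OF hb g(1)])
  have "(LINT x|M. (f x - g x) ^ (2 * n)) \<le>
        (LINT x|M. 4 ^ n * ((f x - h x) ^ (2 * n) + (h x - g x) ^ (2 * n)))"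
  proof (rule integral_mono)
    show "integrable M (\<lambda>x. (f x - g x) ^ (2 * n))"
      by (rule integrable_diff_power[OF f g(1)])
    show "integrable M (\<lambda>x. 4 ^ n * ((f x - h x) ^ (2 * n) + (h x - g x) ^ (2 * n)))"
      by (intro integrable_mult_right Bochner_Integration.integrable_add i1 i2)
    show "(f x - g x) ^ (2 * n) \<le> 4 ^ n * ((f x - h x) ^ (2 * n) + (h x - g x) ^ (2 * n))" for x
      using even_power_add_le[of "f x - h x" "h x - g x" n] by simp
  qed
  also have "\<dots> = 4 ^ n * ((LINT x|M. (f x - h x) ^ (2 * n)) + (LINT x|M. (h x - g x) ^ (2 * n)))"
    using i1 i2 by simp
  also have "\<dots> < 4 ^ n * (d + d)"
    using h(2) g(2) by (intro mult_strict_left_mono) auto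
  also have "\<dots> = e" by (simp add: d_def)
  finally show "\<exists>g\<in>L. (LINT x|M. (f x - g x) ^ (2 * n)) < e" using g(1) by blast
qed

lemma approximable_add:
  assumes f: "approximable f" and g: "approximable g"
  shows "approximable (\<lambda>x. f x + g x)"
  unfolding approximable_def
proof (intro conjI allI impI)
  note fb = approximable_bounded_measurable[OF f] and gb = approximable_bounded_measurable[OF g]
  show fg: "bounded_measurable (\<lambda>x. f x + g x)" by (rule bounded_measurable_add[OF fb gb])
  fix n :: nat and e :: real assume n: "n > 0" and e: "e > 0"
  define d where "d = e / (2 * 4 ^ n)"
  have d: "d > 0" using e by (simp add: d_def)
  obtain f' where f': "f' \<in> L" "(LINT x|M. (f x - f' x) ^ (2 * n)) < d"
    using approximableD[OF f n d] by blast
  obtain g' where g': "g' \<in> L" "(LINT x|M. (g x - g' x) ^ (2 * n)) < d"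
    using approximableD[OF g n d] by blast
  have i1: "integrable M (\<lambda>x. (f x - f' x) ^ (2 * n))"
    by (rule integrable_diff_power[OF fb f'(1)])
  have i2: "integrable M (\<lambda>x. (g x - g' x) ^ (2 * n))"
    by (rule integrable_diff_power[OF gb g'(1)])
  have "(LINT x|M. (f x + g x - (f' x + g' x)) ^ (2 * n)) \<le>
        (LINT x|M. 4 ^ n * ((f x - f' x) ^ (2 * n) + (g x - g' x) ^ (2 * n)))"
  proof (rule integral_mono)
    show "integrable M (\<lambda>x. (f x + g x - (f' x + g' x)) ^ (2 * n))"
      by (rule integrable_diff_power[OF fg add_mem[OF f'(1) g'(1)]])
    show "integrable M (\<lambda>x. 4 ^ n * ((f x - f' x) ^ (2 * n) + (g x - g' x) ^ (2 * n)))"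
      by (intro integrable_mult_right Bochner_Integration.integrable_add i1 i2)
    show "(f x + g x - (f' x + g' x)) ^ (2 * n) \<le>
      4 ^ n * ((f x - f' x) ^ (2 * n) + (g x - g' x) ^ (2 * n))" for x
      using even_power_add_le[of "f x - f' x" "g x - g' x" n] by (simp add: algebra_simps)
  qed
  also have "\<dots> = 4 ^ n * ((LINT x|M. (f x - f' x) ^ (2 * n)) + (LINT x|M. (g x - g' x) ^ (2 * n)))"
    using i1 i2 by simp
  also have "\<dots> < 4 ^ n * (d + d)"
    using f'(2) g'(2) by (intro mult_strict_left_mono) auto
  also have "\<dots> = e" by (simp add: d_def)
  finally show "\<exists>h\<in>L. (LINT x|M. (f x + g x - h x) ^ (2 * n)) < e"
    by (intro bexI[OF _ add_mem[OF f'(1) g'(1)]])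
qed

lemma approximable_mult:
  assumes f: "approximable f" and g: "approximable g"
  shows "approximable (\<lambda>x. f x * g x)"
  unfolding approximable_def
proof (intro conjI allI impI)
  note fb = approximable_bounded_measurable[OF f] and gb = approximable_bounded_measurable[OF g]
  show fg: "bounded_measurable (\<lambda>x. f x * g x)" by (rule bounded_measurable_mult[OF fb gb])
  fix n :: nat and e :: real assume n: "n > 0" and e: "e > 0"
  obtain B where B: "B > 0" "\<And>x. x \<in> space M \<Longrightarrow> \<bar>f x\<bar> \<le> B"
    using bounded_measurable_bound[OF fb] by blast
  define e1 where "e1 = e / (3 * 4 ^ n)"
  have e1: "e1 > 0" using e by (simp add: e1_def)
  have "e1 / B ^ (2 * n) > 0" using e1 B by simp
  then obtain g' where g': "g' \<in> L" "(LINT x|M. (g x - g' x) ^ (2 * n)) < e1 / B ^ (2 * n)"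
    using approximableD[OF g n] by blast
  \<comment> \<open>the precision required of the approximant to \<open>f\<close> depends on the moments of \<open>g'\<close>\<close>
  define I where "I = (LINT x|M. g' x ^ (2 * (2 * n)))"
  have I: "I \<ge> 0" unfolding I_def by (rule Bochner_Integration.integral_nonneg) (simp add: power_mult)
  define d where "d = e1 / (I + 1)"
  have d: "d > 0" using e1 I by (simp add: d_def)
  have "2 * n > 0" "e1 * d > 0" using n d e1 by auto
  then obtain f' where f': "f' \<in> L" "(LINT x|M. (f x - f' x) ^ (2 * (2 * n))) < e1 * d"
    using approximableD[OF f] by blast
  have i1: "integrable M (\<lambda>x. (g x - g' x) ^ (2 * n))"
    by (rule integrable_diff_power[OF gb g'(1)])
  have i2: "integrable M (\<lambda>x. (f x - f' x) ^ (2 * (2 * n)))"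
    by (rule integrable_diff_power[OF fb f'(1)])
  have i3: "integrable M (\<lambda>x. g' x ^ (2 * (2 * n)))"
    by (rule integrable_power_mem[OF g'(1)])
  \<comment> \<open>a form of Young's inequality, in place of Cauchy-Schwarz for the last summand below\<close>
  have young: "a * b \<le> d * a\<^sup>2 + b\<^sup>2 / d" if "a \<ge> 0" "b \<ge> 0" for a b :: real
  proof -
    have "0 \<le> (d * a - b)\<^sup>2" "0 \<le> d * (a * b)" using that d by simp_all
    then have "d * (a * b) \<le> d * (d * a\<^sup>2) + b\<^sup>2"
      unfolding power2_diff by (simp add: power2_eq_square mult_ac)
    also have "\<dots> = d * (d * a\<^sup>2 + b\<^sup>2 / d)" using d by (simp add: distrib_left)
    finally show ?thesis using d by simp
  qed
  have "(LINT x|M. (f x * g x - f' x * g' x) ^ (2 * n)) \<le>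
        (LINT x|M. 4 ^ n * (B ^ (2 * n) * (g x - g' x) ^ (2 * n) +
           (d * g' x ^ (2 * (2 * n)) + (f x - f' x) ^ (2 * (2 * n)) / d)))"
  proof (rule integral_mono)
    show "integrable M (\<lambda>x. (f x * g x - f' x * g' x) ^ (2 * n))"
      by (rule integrable_diff_power[OF fg mult_mem[OF f'(1) g'(1)]])
    show "integrable M (\<lambda>x. 4 ^ n * (B ^ (2 * n) * (g x - g' x) ^ (2 * n) +
           (d * g' x ^ (2 * (2 * n)) + (f x - f' x) ^ (2 * (2 * n)) / d)))"
      by (intro integrable_mult_right Bochner_Integration.integrable_add i1 i2 i3
          Bochner_Integration.integrable_divide)
    fix x assume x: "x \<in> space M"
    have "(f x * g x - f' x * g' x) ^ (2 * n) \<le>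
       4 ^ n * ((f x * (g x - g' x)) ^ (2 * n) + ((f x - f' x) * g' x) ^ (2 * n))"
      using even_power_add_le[of "f x * (g x - g' x)" "(f x - f' x) * g' x" n]
      by (simp add: algebra_simps)
    also have "\<dots> \<le> 4 ^ n * (B ^ (2 * n) * (g x - g' x) ^ (2 * n) +
           (d * g' x ^ (2 * (2 * n)) + (f x - f' x) ^ (2 * (2 * n)) / d))"
    proof (intro mult_left_mono add_mono)
      have "f x ^ (2 * n) = \<bar>f x\<bar> ^ (2 * n)" by (simp add: power_even_abs)
      also have "\<dots> \<le> B ^ (2 * n)" using B(2)[OF x] by (intro power_mono) auto
      finally show "(f x * (g x - g' x)) ^ (2 * n) \<le> B ^ (2 * n) * (g x - g' x) ^ (2 * n)"
        unfolding power_mult_distrib by (intro mult_right_mono) auto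
      show "((f x - f' x) * g' x) ^ (2 * n) \<le> d * g' x ^ (2 * (2 * n)) + (f x - f' x) ^ (2 * (2 * n)) / d"
        using young[OF zero_le_even_power'[of "g' x" n] zero_le_even_power'[of "f x - f' x" n]]
        by (simp add: power_mult_distrib power_mult[symmetric] mult.commute mult.left_commute)
    qed auto
    finally show "(f x * g x - f' x * g' x) ^ (2 * n) \<le> 4 ^ n * (B ^ (2 * n) * (g x - g' x) ^ (2 * n) +
           (d * g' x ^ (2 * (2 * n)) + (f x - f' x) ^ (2 * (2 * n)) / d))" .
  qed
  also have "\<dots> = 4 ^ n * (B ^ (2 * n) * (LINT x|M. (g x - g' x) ^ (2 * n)) +
      (d * I + (LINT x|M. (f x - f' x) ^ (2 * (2 * n))) / d))"
    using i1 i2 i3 by (simp add: I_def)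
  also have "\<dots> < 4 ^ n * (e1 + (e1 + e1))"
  proof (intro mult_strict_left_mono add_strict_mono)
    show "B ^ (2 * n) * (LINT x|M. (g x - g' x) ^ (2 * n)) < e1"
      using g'(2) B(1) by (simp add: field_simps)
    show "d * I < e1" unfolding d_def using e1 I by (simp add: field_simps)
    show "(LINT x|M. (f x - f' x) ^ (2 * (2 * n))) / d < e1"
      using f'(2) d by (simp add: field_simps)
  qed auto
  also have "\<dots> = e" by (simp add: e1_def)
  finally show "\<exists>h\<in>L. (LINT x|M. (f x * g x - h x) ^ (2 * n)) < e"
    by (intro bexI[OF _ mult_mem[OF f'(1) g'(1)]])
qed

lemma approximable_bounded_limit:
  assumes f: "\<And>j. approximable (f j)" and B: "\<And>j x. x \<in> space M \<Longrightarrow> \<bar>f j x\<bar> \<le> B"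
    and lim: "\<And>x. x \<in> space M \<Longrightarrow> (\<lambda>j. f j x) \<longlonglongrightarrow> g x"
  shows "approximable g"
proof (rule approximable_closure)
  have [measurable]: "f j \<in> borel_measurable M" for j
    by (rule bounded_measurable_measurable[OF approximable_bounded_measurable[OF f]])
  have [measurable]: "g \<in> borel_measurable M"
    by (rule borel_measurable_LIMSEQ_real[OF lim]) auto
  have gB: "\<bar>g x\<bar> \<le> B" if "x \<in> space M" for x
    by (rule tendsto_upperbound[OF tendsto_rabs[OF lim[OF that]]]) (auto simp: B that)
  then show g: "bounded_measurable g" by (auto simp: bounded_measurable_def)
  fix n :: nat and e :: real assume n: "n > 0" and e: "e > 0"
  have "(\<lambda>j. LINT x|M. (g x - f j x) ^ (2 * n)) \<longlonglongrightarrow> (LINT x|M. 0)"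
  proof (rule integral_dominated_convergence[where w = "\<lambda>_. (2 * B) ^ (2 * n)"])
    show "AE x in M. (\<lambda>j. (g x - f j x) ^ (2 * n)) \<longlonglongrightarrow> 0"
    proof (rule AE_I2)
      fix x assume x: "x \<in> space M"
      have "(\<lambda>j. (g x - f j x) ^ (2 * n)) \<longlonglongrightarrow> (g x - g x) ^ (2 * n)"
        by (intro tendsto_intros lim x)
      then show "(\<lambda>j. (g x - f j x) ^ (2 * n)) \<longlonglongrightarrow> 0" using n by (simp add: zero_power)
    qed
    show "AE x in M. norm ((g x - f j x) ^ (2 * n)) \<le> (2 * B) ^ (2 * n)" for j
    proof (rule AE_I2)
      fix x assume x: "x \<in> space M"
      have "\<bar>g x - f j x\<bar> \<le> 2 * B" using gB[OF x] B[OF x, of j] by linarith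
      then show "norm ((g x - f j x) ^ (2 * n)) \<le> (2 * B) ^ (2 * n)"
        unfolding real_norm_def power_abs by (intro power_mono) auto
    qed
  qed auto
  then have "eventually (\<lambda>j. (LINT x|M. (g x - f j x) ^ (2 * n)) < e) sequentially"
    using e by (intro order_tendstoD) auto
  then obtain j where "(LINT x|M. (g x - f j x) ^ (2 * n)) < e"
    by (auto simp: eventually_sequentially)
  then show "\<exists>h. approximable h \<and> (LINT x|M. (g x - h x) ^ (2 * n)) < e" using f by blast
qed

lemma approximable_polynomial:
  assumes "approximable f" "real_polynomial_function p"
  shows "approximable (\<lambda>x. p (f x))"
  using assms(2)
proof induction
  case (linear q)
  then have q: "q y = y * q 1" for y
    using linear_scale[OF bounded_linear.linear, of q y 1] by simp
  show ?case
    by (subst q) (rule approximable_mult[OF assms(1) approximable_const])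
next
  case (const c)
  show ?case by (rule approximable_const)
next
  case (add p q)
  from this(3,4) show ?case by (rule approximable_add)
next
  case (mult p q)
  from this(3,4) show ?case by (rule approximable_mult)
qed

lemma approximable_continuous:
  assumes f: "approximable f" and c: "continuous_on UNIV (\<phi> :: real \<Rightarrow> real)"
  shows "approximable (\<lambda>x. \<phi> (f x))"
proof -
  obtain B where B: "B > 0" "\<And>x. x \<in> space M \<Longrightarrow> \<bar>f x\<bar> \<le> B"
    using bounded_measurable_bound[OF approximable_bounded_measurable[OF f]] by blast
  define K where "K = {-B..B}"
  have cK: "continuous_on K \<phi>" using c by (rule continuous_on_subset) simp
  have "\<exists>p. real_polynomial_function p \<and> (\<forall>y\<in>K. \<bar>\<phi> y - p y\<bar> < 1 / real (Suc j))" for j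
  proof -
    have "compact K" by (simp add: K_def)
    moreover have "0 < 1 / real (Suc j)" by simp
    ultimately obtain p where "real_polynomial_function p"
      "\<And>y. y \<in> K \<Longrightarrow> \<bar>\<phi> y - p y\<bar> < 1 / real (Suc j)"
      using Stone_Weierstrass_real_polynomial_function[OF _ cK] by blast
    then show ?thesis by blast
  qed
  then obtain p where p: "\<And>j. real_polynomial_function (p j)"
    "\<And>j y. y \<in> K \<Longrightarrow> \<bar>\<phi> y - p j y\<bar> < 1 / real (Suc j)" by metis
  have fK: "f x \<in> K" if "x \<in> space M" for x using B(2)[OF that] by (auto simp: K_def)
  have "compact (\<phi> ` K)" using cK by (intro compact_continuous_image) (auto simp: K_def)
  then obtain C where "\<forall>z\<in>\<phi> ` K. norm z \<le> C"
    using compact_imp_bounded bounded_iff by blast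
  then have C: "\<bar>\<phi> y\<bar> \<le> C" if "y \<in> K" for y using that by auto
  show ?thesis
  proof (rule approximable_bounded_limit[where f = "\<lambda>j x. p j (f x)" and B = "C + 1"])
    show "approximable (\<lambda>x. p j (f x))" for j by (rule approximable_polynomial[OF f p(1)])
    fix x assume x: "x \<in> space M"
    show "\<bar>p j (f x)\<bar> \<le> C + 1" for j
    proof -
      have "1 / real (Suc j) \<le> 1" by simp
      then show ?thesis using p(2)[OF fK[OF x], of j] C[OF fK[OF x]] by linarith
    qed
    have "(\<lambda>j. p j (f x) - \<phi> (f x)) \<longlonglongrightarrow> 0"
    proof (rule Lim_null_comparison[OF always_eventually])
      show "\<forall>j. norm (p j (f x) - \<phi> (f x)) \<le> 1 / real (Suc j)"
        using p(2)[OF fK[OF x]] by (auto simp: abs_minus_commute intro: less_imp_le)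
      show "(\<lambda>j. 1 / real (Suc j)) \<longlonglongrightarrow> 0" by (rule LIMSEQ_Suc) (rule lim_1_over_n)
    qed
    then show "(\<lambda>j. p j (f x)) \<longlonglongrightarrow> \<phi> (f x)" using LIM_zero_iff by blast
  qed
qed

text \<open>
The events with approximable indicator function. They form a sigma-algebra, because the approximable
functions are closed under products and bounded pointwise limits; every approximable function is
measurable with respect to it.
\<close>

definition approximable_events :: "'a set set" where
  "approximable_events = {X \<in> sets M. approximable (indicator X)}"

lemma approximable_cong:
  assumes "approximable f" "\<And>x. x \<in> space M \<Longrightarrow> f x = g x"
  shows "approximable g"
proof -
  obtain B where B: "\<And>x. x \<in> space M \<Longrightarrow> \<bar>f x\<bar> \<le> B"
    using bounded_measurable_bound[OF approximable_bounded_measurable[OF assms(1)]] by blast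
  show ?thesis
    by (rule approximable_bounded_limit[where f = "\<lambda>_. f" and B = B])
       (auto simp: assms(2)[symmetric] B intro: assms(1))
qed

lemma sigma_algebra_approximable_events: "sigma_algebra (space M) approximable_events"
proof -
  have compl: "space M - X \<in> approximable_events" if "X \<in> approximable_events" for X
  proof -
    have "approximable (\<lambda>x. 1 + (-1) * indicator X x)"
      using that by (intro approximable_add approximable_mult approximable_const)
        (auto simp: approximable_events_def)
    then have "approximable (indicator (space M - X))"
      by (rule approximable_cong) (auto simp: indicator_def)
    with that show ?thesis by (auto simp: approximable_events_def)
  qed
  have int: "X \<inter> Y \<in> approximable_events" if "X \<in> approximable_events" "Y \<in> approximable_events" for X Y
  proof -
    have "approximable (\<lambda>x. indicator X x * indicator Y x)"
      using that by (intro approximable_mult) (auto simp: approximable_events_def)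
    then have "approximable (indicator (X \<inter> Y))"
      by (rule approximable_cong) (auto simp: indicator_def)
    with that show ?thesis by (auto simp: approximable_events_def)
  qed
  have "space M - {} \<in> approximable_events"
  proof -
    have "approximable (indicator (space M))"
      by (rule approximable_cong[OF approximable_const[of 1]]) auto
    then show ?thesis by (auto simp: approximable_events_def)
  qed
  then have empty: "{} \<in> approximable_events" using compl by fastforce
  have un: "X \<union> Y \<in> approximable_events" if "X \<in> approximable_events" "Y \<in> approximable_events" for X Y
  proof -
    have "X \<subseteq> space M" "Y \<subseteq> space M"
      using that by (auto simp: approximable_events_def dest: sets.sets_into_space)
    then have "X \<union> Y = space M - ((space M - X) \<inter> (space M - Y))" by blast
    then show ?thesis using compl int that by simp
  qed
  show ?thesis
  proof (rule sigma_algebra.intro)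
    show "algebra (space M) approximable_events"
      unfolding algebra_iff_Un
      using compl un empty by (auto simp: approximable_events_def dest: sets.sets_into_space)
    show "sigma_algebra_axioms approximable_events"
    proof
      fix A :: "nat \<Rightarrow> 'a set" assume A: "range A \<subseteq> approximable_events"
      have fin: "(\<Union>i<n. A i) \<in> approximable_events" for n
      proof (induction n)
        case (Suc n)
        then show ?case using un[of "\<Union>i<n. A i" "A n"] A by (auto simp: lessThan_Suc Un_commute)
      qed (simp add: empty)
      have "approximable (indicator (\<Union>i. A i))"
      proof (rule approximable_bounded_limit[where B = 1])
        show "approximable (indicator (\<Union>i<n. A i))" for n
          using fin[of n] by (simp add: approximable_events_def)
        show "(\<lambda>n. indicator (\<Union>i<n. A i) x :: real) \<longlonglongrightarrow> indicator (\<Union>i. A i) x" for x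
          by (rule LIMSEQ_indicator_UN)
      qed (auto simp: indicator_def)
      moreover have "(\<Union>i. A i) \<in> sets M" using A by (auto simp: approximable_events_def)
      ultimately show "(\<Union>i. A i) \<in> approximable_events" by (simp add: approximable_events_def)
    qed
  qed
qed

definition approximable_algebra :: "'a measure" where
  "approximable_algebra = sigma (space M) approximable_events"

lemma space_approximable_algebra: "space approximable_algebra = space M"
  unfolding approximable_algebra_def
  by (rule space_measure_of) (auto simp: approximable_events_def dest: sets.sets_into_space)

lemma sets_approximable_algebra: "sets approximable_algebra = approximable_events"
  unfolding approximable_algebra_def
  by (rule sigma_algebra.sets_measure_of_eq[OF sigma_algebra_approximable_events])

lemma approximable_measurable:
  assumes f: "approximable f"
  shows "f \<in> borel_measurable approximable_algebra"
proof (rule borel_measurableI_greater)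
  fix c :: real
  have fM [measurable]: "f \<in> borel_measurable M"
    by (rule bounded_measurable_measurable[OF approximable_bounded_measurable[OF f]])
  let ?X = "{x \<in> space M. c < f x}"
  \<comment> \<open>continuous functions increasing to the indicator function of the half-line above \<open>c\<close>\<close>
  define \<phi> where "\<phi> j y = min 1 (real j * max 0 (y - c))" for j y
  have "approximable (indicator ?X)"
  proof (rule approximable_bounded_limit[where B = 1])
    show "approximable (\<lambda>x. \<phi> j (f x))" for j
      unfolding \<phi>_def by (rule approximable_continuous[OF f]) (intro continuous_intros)
    show "\<bar>\<phi> j (f x)\<bar> \<le> 1" for j x by (simp add: \<phi>_def)
    fix x assume x: "x \<in> space M"
    show "(\<lambda>j. \<phi> j (f x)) \<longlonglongrightarrow> indicator ?X x"
    proof (cases "c < f x")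
      case True
      obtain N where N: "1 / (f x - c) < real N" using reals_Archimedean2 by blast
      have "\<phi> j (f x) = 1" if "j \<ge> N" for j
      proof -
        have "1 / (f x - c) < real j" using N that by simp
        then show ?thesis using True by (simp add: \<phi>_def field_simps)
      qed
      then have "eventually (\<lambda>j. \<phi> j (f x) = indicator ?X x) sequentially"
        using True x by (auto simp: eventually_sequentially)
      then show ?thesis by (rule tendsto_eventually)
    qed (auto simp: \<phi>_def)
  qed
  then show "{x \<in> space approximable_algebra. c < f x} \<in> sets approximable_algebra"
    by (simp add: space_approximable_algebra sets_approximable_algebra approximable_events_def)
qed

lemma integrable_powr_mem:
  assumes "g \<in> L" "p \<ge> 0"
  shows "integrable M (\<lambda>x. \<bar>g x\<bar> powr p)"
proof -
  obtain n :: nat where n: "p \<le> real n" using real_arch_simple by blast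
  show ?thesis
  proof (rule Bochner_Integration.integrable_bound)
  show "integrable M (\<lambda>x. 1 powr p + 1 powr (p - 2 * n) * g x ^ (2 * n))"
    using assms by (intro Bochner_Integration.integrable_add integrable_mult_right integrable_power_mem) auto
  show "(\<lambda>x. \<bar>g x\<bar> powr p) \<in> borel_measurable M" using assms by measurable
  show "AE x in M. norm (\<bar>g x\<bar> powr p) \<le> norm (1 powr p + 1 powr (p - 2 * n) * g x ^ (2 * n))"
    using powr_le_even_power[of p n 1] assms n by (intro AE_I2) (auto intro: order_trans[OF _ abs_ge_self])
  qed
qed

lemma approximable_sum:
  assumes "\<And>i. i \<in> I \<Longrightarrow> approximable (f i)"
  shows "approximable (\<lambda>x. \<Sum>i\<in>I. f i x)"
proof (cases "finite I")
  case True
  then show ?thesis using assms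
    by (induction I) (auto intro: approximable_const approximable_add)
qed (simp add: approximable_const)

lemma approximable_simple_function:
  fixes s :: "'a \<Rightarrow> real"
  assumes "sets M \<subseteq> sets approximable_algebra" "simple_function M s"
  shows "approximable s"
proof (rule approximable_cong)
  show "approximable (\<lambda>x. \<Sum>y\<in>s ` space M. y * indicator (s -` {y} \<inter> space M) x)"
  proof (intro approximable_sum approximable_mult approximable_const)
    fix y
    have "s -` {y} \<inter> space M \<in> sets M" using assms(2) by (rule simple_functionD(2))
    then show "approximable (indicator (s -` {y} \<inter> space M))"
      using assms(1) by (auto simp: sets_approximable_algebra approximable_events_def)
  qed
  fix x assume x: "x \<in> space M"
  have fin: "finite (s ` space M)" using assms(2) by (rule simple_functionD(1))
  have "(\<Sum>y\<in>s ` space M. y * indicator (s -` {y} \<inter> space M) x) =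
        (\<Sum>y\<in>s ` space M. if y = s x then s x else 0)"
    using x by (intro sum.cong) (auto simp: indicator_def)
  then show "(\<Sum>y\<in>s ` space M. y * indicator (s -` {y} \<inter> space M) x) = s x"
    using x fin by (simp add: sum.delta)
qed

lemma approximable_powr:
  assumes s: "approximable s" and p: "p \<ge> 1" and e: "e > 0"
  shows "\<exists>g\<in>L. integrable M (\<lambda>x. \<bar>s x - g x\<bar> powr p) \<and> (LINT x|M. \<bar>s x - g x\<bar> powr p) < e"
proof -
  obtain n :: nat where n: "p \<le> real n" using real_arch_simple by blast
  with p have n0: "n > 0" by (cases n) auto
  define d where "d = (e / 2) powr (1 / p)"
  have d: "d > 0" "d powr p = e / 2" using e p by (auto simp: d_def powr_powr)
  define c where "c = d powr (p - 2 * n)"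
  have c: "c > 0" using d by (simp add: c_def)
  have "e / (2 * c) > 0" using e c by simp
  then obtain g where g: "g \<in> L" "(LINT x|M. (s x - g x) ^ (2 * n)) < e / (2 * c)"
    using approximableD[OF s n0] by blast
  note sb = approximable_bounded_measurable[OF s]
  have ig: "integrable M (\<lambda>x. (s x - g x) ^ (2 * n))" by (rule integrable_diff_power[OF sb g(1)])
  have bnd: "\<bar>s x - g x\<bar> powr p \<le> e / 2 + c * (s x - g x) ^ (2 * n)" for x
    using powr_le_even_power[of p n d "s x - g x"] p n d by (simp add: c_def)
  have ib: "integrable M (\<lambda>x. e / 2 + c * (s x - g x) ^ (2 * n))"
    using ig by (intro Bochner_Integration.integrable_add integrable_mult_right) auto
  have i: "integrable M (\<lambda>x. \<bar>s x - g x\<bar> powr p)"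
  proof (rule Bochner_Integration.integrable_bound[OF ib])
    show "(\<lambda>x. \<bar>s x - g x\<bar> powr p) \<in> borel_measurable M"
      using bounded_measurable_measurable[OF sb] measurable_mem[OF g(1)] by measurable
    show "AE x in M. norm (\<bar>s x - g x\<bar> powr p) \<le> norm (e / 2 + c * (s x - g x) ^ (2 * n))"
      using bnd by (intro AE_I2) (auto intro: order_trans[OF _ abs_ge_self])
  qed
  have "(LINT x|M. \<bar>s x - g x\<bar> powr p) \<le> (LINT x|M. e / 2 + c * (s x - g x) ^ (2 * n))"
    by (rule integral_mono[OF i ib bnd])
  also have "\<dots> = e / 2 + c * (LINT x|M. (s x - g x) ^ (2 * n))"
    using ig by (simp add: prob_space)
  also have "\<dots> < e / 2 + c * (e / (2 * c))"
    using g(2) c by (intro add_strict_left_mono mult_strict_left_mono) auto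
  also have "\<dots> = e" using c by simp
  finally show ?thesis using g(1) i by blast
qed

text \<open>
If every event is approximable, then so are the simple functions, and these are dense in \<open>L^p\<close>.
\<close>

lemma dense_powr:
  assumes sets: "sets M \<subseteq> sets approximable_algebra"
    and p: "p \<ge> 1" and f [measurable]: "f \<in> borel_measurable M"
    and i: "integrable M (\<lambda>x. \<bar>f x\<bar> powr p)" and e: "e > 0"
  shows "\<exists>g\<in>L. (LINT x|M. \<bar>f x - g x\<bar> powr p) < e"
proof -
  define d where "d = e / (2 * 2 powr p)"
  have d: "d > 0" using e by (simp add: d_def)
  obtain s where s: "\<And>j. simple_function M (s j)"
    "\<And>x. x \<in> space M \<Longrightarrow> (\<lambda>j. s j x) \<longlonglongrightarrow> f x"
    "\<And>j x. x \<in> space M \<Longrightarrow> norm (s j x) \<le> 2 * norm (f x)"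
    using borel_measurable_implies_sequence_metric[OF f, of 0] unfolding dist_0_norm by (metis dist_0_norm dist_commute)
  have [measurable]: "s j \<in> borel_measurable M" for j by (rule borel_measurable_simple_function[OF s(1)])
  have bnd: "\<bar>f x - s j x\<bar> powr p \<le> 3 powr p * \<bar>f x\<bar> powr p" if "x \<in> space M" for x j
  proof -
    have "\<bar>f x - s j x\<bar> \<le> 3 * \<bar>f x\<bar>" using s(3)[OF that, of j] by simp
    then have "\<bar>f x - s j x\<bar> powr p \<le> (3 * \<bar>f x\<bar>) powr p" using p by (intro powr_mono2) auto
    then show ?thesis by (simp add: powr_mult)
  qed
  have i3: "integrable M (\<lambda>x. 3 powr p * \<bar>f x\<bar> powr p)" using i by (rule integrable_mult_right)
  have "(\<lambda>j. LINT x|M. \<bar>f x - s j x\<bar> powr p) \<longlonglongrightarrow> (LINT x|M. 0)"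
  proof (rule integral_dominated_convergence[OF _ _ i3])
    show "AE x in M. (\<lambda>j. \<bar>f x - s j x\<bar> powr p) \<longlonglongrightarrow> 0"
    proof (rule AE_I2)
      fix x assume x: "x \<in> space M"
      have "(\<lambda>j. \<bar>f x - s j x\<bar> powr p) \<longlonglongrightarrow> \<bar>f x - f x\<bar> powr p"
        using p by (intro tendsto_powr' tendsto_intros s(2)[OF x]) auto
      then show "(\<lambda>j. \<bar>f x - s j x\<bar> powr p) \<longlonglongrightarrow> 0" by simp
    qed
    show "AE x in M. norm (\<bar>f x - s j x\<bar> powr p) \<le> 3 powr p * \<bar>f x\<bar> powr p" for j
      using bnd by (intro AE_I2) simp
  qed auto
  then have "eventually (\<lambda>j. (LINT x|M. \<bar>f x - s j x\<bar> powr p) < d) sequentially"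
    using d by (intro order_tendstoD) auto
  then obtain j where j: "(LINT x|M. \<bar>f x - s j x\<bar> powr p) < d"
    by (auto simp: eventually_sequentially)
  have i1: "integrable M (\<lambda>x. \<bar>f x - s j x\<bar> powr p)"
  proof (rule Bochner_Integration.integrable_bound[OF i3])
    show "AE x in M. norm (\<bar>f x - s j x\<bar> powr p) \<le> norm (3 powr p * \<bar>f x\<bar> powr p)"
      using bnd by (intro AE_I2) (auto intro: order_trans[OF _ abs_ge_self])
  qed auto
  obtain g where g: "g \<in> L" "integrable M (\<lambda>x. \<bar>s j x - g x\<bar> powr p)"
    "(LINT x|M. \<bar>s j x - g x\<bar> powr p) < d"
    using approximable_powr[OF approximable_simple_function[OF sets s(1)] p d] by blast
  have tri: "\<bar>f x - g x\<bar> powr p \<le> 2 powr p * (\<bar>f x - s j x\<bar> powr p + \<bar>s j x - g x\<bar> powr p)" for x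
    using powr_add_le[of p "f x - s j x" "s j x - g x"] p by simp
  have i2: "integrable M (\<lambda>x. 2 powr p * (\<bar>f x - s j x\<bar> powr p + \<bar>s j x - g x\<bar> powr p))"
    using i1 g(2) by (intro integrable_mult_right Bochner_Integration.integrable_add)
  have "(LINT x|M. \<bar>f x - g x\<bar> powr p) \<le>
      (LINT x|M. 2 powr p * (\<bar>f x - s j x\<bar> powr p + \<bar>s j x - g x\<bar> powr p))"
    using i2 tri by (rule integral_mono') simp
  also have "\<dots> = 2 powr p * ((LINT x|M. \<bar>f x - s j x\<bar> powr p) + (LINT x|M. \<bar>s j x - g x\<bar> powr p))"
    using i1 g(2) by simp
  also have "\<dots> < 2 powr p * (d + d)"
    using j g(3) by (intro mult_strict_left_mono add_strict_mono) auto
  also have "\<dots> = e" by (simp add: d_def)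
  finally show ?thesis using g(1) by blast
qed

end

section \<open>The projective norm in coordinates\<close>

text \<open>
The words of length \<open>k\<close>, a basis of the tensors of degree \<open>k\<close>.
\<close>

definition words :: "nat \<Rightarrow> 'd::finite list set" where
  "words k = {w. length w = k}"

lemma words_iff: "w \<in> words k \<longleftrightarrow> length w = k"
  by (simp add: words_def)

lemma finite_words [simp]: "finite (words k :: 'd::finite list set)"
  using finite_lists_length_eq[of "UNIV :: 'd set" k] by (simp add: words_def)

lemma card_words: "card (words k :: 'd::finite list set) = CARD('d) ^ k"
  using card_lists_length_eq[of "UNIV :: 'd set" k] by (simp add: words_def)

lemma words_0: "words 0 = {[]}"
  by (auto simp: words_def)

lemma words_Suc: "words (Suc k) = (\<lambda>(a, w). a # w) ` (UNIV \<times> words k)"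
  by (auto simp: words_def length_Suc_conv image_iff)

lemma sum_words_Suc:
  "(\<Sum>w\<in>words (Suc k). f w) = (\<Sum>a\<in>UNIV. \<Sum>w\<in>words k. f (a # w))"
  unfolding words_Suc
  by (subst sum.reindex) (auto simp: inj_on_def sum.cartesian_product case_prod_unfold)

text \<open>
The \<open>l1\<close> norm of the coefficients of degree \<open>k\<close>; coefficients of other degrees are ignored.
\<close>

definition level_norm :: "nat \<Rightarrow> 'd::finite tensor_series \<Rightarrow> real" where
  "level_norm k t = (\<Sum>w\<in>words k. \<bar>t w\<bar>)"

lemma level_norm_nonneg: "level_norm k t \<ge> 0"
  by (simp add: level_norm_def sum_nonneg)

lemma abs_le_level_norm: "\<bar>t w\<bar> \<le> level_norm (length w) t"
  unfolding level_norm_def by (rule member_le_sum) (auto simp: words_iff)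

lemma level_norm_elementary_tensor:
  "level_norm k (elementary_tensor k v) = (\<Prod>j<k. l1_norm (v j))"
proof -
  have "(\<Sum>w\<in>words k. \<bar>\<Prod>j<k. v j $ (w ! j)\<bar>) = (\<Prod>j<k. l1_norm (v j))"
  proof (induction k arbitrary: v)
    case (Suc k)
    have "(\<Sum>w\<in>words (Suc k). \<bar>\<Prod>j<Suc k. v j $ (w ! j)\<bar>) =
      (\<Sum>a\<in>UNIV. \<Sum>w\<in>words k. \<bar>v 0 $ a\<bar> * \<bar>\<Prod>j<k. v (Suc j) $ (w ! j)\<bar>)"
      by (simp add: sum_words_Suc prod.lessThan_Suc_shift abs_mult del: prod.lessThan_Suc)
    also have "\<dots> = (\<Sum>a\<in>UNIV. \<bar>v 0 $ a\<bar>) * (\<Prod>j<k. l1_norm (v (Suc j)))"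
      by (simp add: sum_distrib_left[symmetric] Suc.IH[of "\<lambda>j. v (Suc j)"] sum_distrib_right)
    also have "\<dots> = (\<Prod>j<Suc k. l1_norm (v j))"
      by (simp add: prod.lessThan_Suc_shift l1_norm_def del: prod.lessThan_Suc)
    finally show ?case .
  qed (simp add: words_0)
  then show ?thesis
    by (auto simp: level_norm_def elementary_tensor_def level_def words_iff intro!: sum.cong)
qed

text \<open>
The projective tensor power of the \<open>l1\<close> norm is the \<open>l1\<close> norm: the former is the largest norm with
the given values on elementary tensors, and the expansion in the basis of words attains the bound.
\<close>

lemma projective_norm_level: "projective_norm k (level k t) = level_norm k t"
proof -
  let ?P = "{(\<Sum>i<n. \<bar>c i\<bar> * (\<Prod>j<k. l1_norm (v i j))) | (n :: nat) (c :: nat \<Rightarrow> real)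
            (v :: nat \<Rightarrow> nat \<Rightarrow> real ^ 'a).
            level k t = (\<lambda>w. \<Sum>i<n. c i * elementary_tensor k (v i) w)}"
  have lower: "level_norm k t \<le> x" if xP: "x \<in> ?P" for x
  proof -
    obtain n :: nat and c v where x: "x = (\<Sum>i<n. \<bar>c i\<bar> * (\<Prod>j<k. l1_norm (v i j)))"
      and t: "level k t = (\<lambda>w. \<Sum>i<n. c i * elementary_tensor k (v i :: nat \<Rightarrow> real ^ 'a) w)"
      using xP by auto
    have "level_norm k t = (\<Sum>w\<in>words k. \<bar>level k t w\<bar>)"
      by (simp add: level_norm_def level_def words_iff)
    also have "\<dots> \<le> (\<Sum>w\<in>words k. \<Sum>i<n. \<bar>c i\<bar> * \<bar>elementary_tensor k (v i) w\<bar>)"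
      unfolding t by (intro sum_mono order_trans[OF sum_abs]) (simp add: abs_mult)
    also have "\<dots> = (\<Sum>i<n. \<bar>c i\<bar> * level_norm k (elementary_tensor k (v i)))"
      unfolding level_norm_def sum_distrib_left by (rule sum.swap)
    finally show ?thesis by (simp add: x level_norm_elementary_tensor)
  qed
  have attained: "level_norm k t \<in> ?P"
  proof -
    \<comment> \<open>the decomposition attaining the infimum runs through the basis vectors \<open>h i\<close>\<close>
    obtain h where h: "bij_betw h {..<card (words k :: 'a list set)} (words k :: 'a list set)"
      using ex_bij_betw_nat_finite[of "words k :: 'a list set"] by (auto simp: atLeast0LessThan)
    let ?n = "card (words k :: 'a list set)"
    define v :: "nat \<Rightarrow> nat \<Rightarrow> real ^ 'a" where "v i j = (\<chi> a. if a = h i ! j then 1 else 0)" for i j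
    have l1: "l1_norm (v i j) = 1" for i j
      by (simp add: l1_norm_def v_def if_distrib cong: if_cong)
    have et: "elementary_tensor k (v i) w = (if w = h i then 1 else 0)" if "i < ?n" for i w
    proof -
      have hk: "length (h i) = k" using h that by (auto simp: bij_betw_def words_iff)
      show ?thesis
      proof (cases "length w = k")
        case True
        then have "w = h i \<longleftrightarrow> (\<forall>j\<in>{..<k}. w ! j = h i ! j)"
          using hk by (auto simp: list_eq_iff_nth_eq)
        moreover have "(\<Prod>j<k. v i j $ (w ! j)) = (if \<forall>j\<in>{..<k}. w ! j = h i ! j then 1 else 0)"
          by (auto simp: v_def prod_zero_iff intro!: prod.neutral)
        ultimately show ?thesis using True by (simp add: elementary_tensor_def level_def)
      qed (use hk in \<open>auto simp: elementary_tensor_def level_def\<close>)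
    qed
    have "level k t = (\<lambda>w. \<Sum>i<?n. t (h i) * elementary_tensor k (v i) w)"
    proof
      fix w
      have "(\<Sum>i<?n. t (h i) * elementary_tensor k (v i) w) =
            (\<Sum>i<?n. t (h i) * (if w = h i then 1 else 0))"
        by (intro sum.cong) (auto simp: et)
      also have "\<dots> = (\<Sum>u\<in>words k. t u * (if w = u then 1 else 0))"
        by (rule sum.reindex_bij_betw[OF h])
      also have "\<dots> = level k t w"
        by (simp add: if_distrib words_iff level_def cong: if_cong)
      finally show "level k t w = (\<Sum>i<?n. t (h i) * elementary_tensor k (v i) w)" by simp
    qed
    moreover have "level_norm k t = (\<Sum>i<?n. \<bar>t (h i)\<bar> * (\<Prod>j<k. l1_norm (v i j)))"
      using sum.reindex_bij_betw[OF h, of "\<lambda>w. \<bar>t w\<bar>"] by (simp add: level_norm_def l1)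
    ultimately show ?thesis
      by (intro CollectI exI[of _ ?n] exI[of _ "\<lambda>i. t (h i)"] exI[of _ v] conjI)
  qed
  have "Inf ?P = level_norm k t" using attained lower by (rule cInf_eq_minimum)
  then show ?thesis unfolding projective_norm_def .
qed

lemma level_norm_triangle:
  "level_norm k (\<lambda>w. S w - U w) \<le> level_norm k (\<lambda>w. S w - T w) + level_norm k (\<lambda>w. T w - U w)"
  unfolding level_norm_def sum.distrib[symmetric] by (intro sum_mono) linarith

section \<open>Powers of coordinates and shuffles\<close>

lemma length_shuffle_product:
  "w \<in># shuffle_product u v \<Longrightarrow> length w = length u + length v"
  by (induction u v arbitrary: w rule: shuffle_product.induct) auto

lemma size_shuffle_product_le: "size (shuffle_product u v) \<le> 2 ^ (length u + length v)"
  by (induction u v rule: shuffle_product.induct) auto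

lemma group_like_mult:
  "S \<in> group_like \<Longrightarrow> S u * S v = (\<Sum>w\<in>#shuffle_product u v. S w)"
  by (auto simp: group_like_def)

text \<open>
The \<open>n\<close>-fold shuffle product of a word with itself, as a formal sum of words.
\<close>

fun shuffle_power :: "'a list \<Rightarrow> nat \<Rightarrow> 'a list multiset" where
  "shuffle_power w 0 = {#[]#}"
| "shuffle_power w (Suc n) = (\<Sum>v\<in>#shuffle_power w n. shuffle_product w v)"

lemma length_shuffle_power: "v \<in># shuffle_power w n \<Longrightarrow> length v = n * length w"
  by (induction n arbitrary: v) (auto dest!: length_shuffle_product)

text \<open>
For fixed \<open>n\<close> the bound is exponential in the length of \<open>w\<close>. Dependence on \<open>n\<close> does not matter below,
so the crude bound by powers of two suffices in place of multinomial coefficients.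
\<close>

lemma size_shuffle_power_le: "size (shuffle_power w n) \<le> (2 ^ n\<^sup>2) ^ length w"
proof (induction n)
  case (Suc n)
  have "size (shuffle_power w (Suc n)) = (\<Sum>v\<in>#shuffle_power w n. size (shuffle_product w v))"
    by (simp add: multiset.map_comp comp_def)
  also have "\<dots> \<le> (\<Sum>v\<in>#shuffle_power w n. 2 ^ (Suc n * length w))"
  proof (rule sum_mset_mono)
    fix v assume "v \<in># shuffle_power w n"
    then have "length w + length v = Suc n * length w" by (simp add: length_shuffle_power)
    then show "size (shuffle_product w v) \<le> 2 ^ (Suc n * length w)"
      using size_shuffle_product_le[of w v] by simp
  qed
  also have "\<dots> = size (shuffle_power w n) * 2 ^ (Suc n * length w)" by (simp add: mult.commute)
  also have "\<dots> \<le> (2 ^ n\<^sup>2) ^ length w * 2 ^ (Suc n * length w)"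
    using Suc.IH by (rule mult_right_mono) simp
  also have "\<dots> = 2 ^ ((n\<^sup>2 + Suc n) * length w)"
    by (simp only: power_mult[symmetric] power_add[symmetric] distrib_right)
  also have "\<dots> \<le> 2 ^ ((Suc n)\<^sup>2 * length w)"
    by (intro power_increasing mult_right_mono) (auto simp: power2_eq_square)
  finally show ?case by (simp only: power_mult)
qed simp

lemma group_like_power:
  assumes "S \<in> group_like"
  shows "S w ^ n = (\<Sum>v\<in>#shuffle_power w n. S v)"
proof (induction n)
  case (Suc n)
  have "S w * (\<Sum>v\<in>#A. S v) = (\<Sum>u\<in>#(\<Sum>v\<in>#A. shuffle_product w v). S u)" for A
    by (induction A) (auto simp: distrib_left group_like_mult[OF assms])
  then show ?case by (simp add: Suc.IH)
qed (use assms in \<open>simp add: group_like_def\<close>)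

lemma group_like_fin_summable:
  assumes "S \<in> group_like_fin" "l \<ge> 0"
  shows "summable (\<lambda>k. l ^ k * level_norm k S)"
proof (cases "l = 0")
  case True
  have "summable (\<lambda>k. 0 ^ k * level_norm k S)"
    by (rule summable_finite[of "{0}"]) (auto simp: zero_power)
  then show ?thesis using True by simp
qed (use assms in \<open>auto simp: group_like_fin_def projective_norm_level\<close>)

lemma group_like_fin_group_like: "S \<in> group_like_fin \<Longrightarrow> S \<in> group_like"
  by (simp add: group_like_fin_def)

text \<open>
The functions that agree with a linear coordinate function on \<open>group_like_fin\<close>. Only on group-like
elements is a product of coordinates again linear, so unlike \<open>linear_coordinate_functions\<close> itself
this set is closed under products.
\<close>

definition coordinate_span :: "('d::finite tensor_series \<Rightarrow> real) set" where
  "coordinate_span = {g. \<exists>h\<in>linear_coordinate_functions. \<forall>S\<in>group_like_fin. g S = h S}"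

lemma coordinate_span_cong:
  "g \<in> coordinate_span \<Longrightarrow> (\<And>S. S \<in> group_like_fin \<Longrightarrow> f S = g S) \<Longrightarrow> f \<in> coordinate_span"
  unfolding coordinate_span_def by auto

lemma coordinate_in_span: "(\<lambda>S. c * S w) \<in> coordinate_span"
proof -
  have "(\<lambda>S. \<Sum>w\<in>{w}. c * S w) \<in> linear_coordinate_functions"
    unfolding linear_coordinate_functions_def
    by (intro CollectI exI[of _ "{w}"] exI[of _ "\<lambda>_. c"]) simp
  then show ?thesis by (auto simp: coordinate_span_def)
qed

lemma const_in_span: "(\<lambda>_. c) \<in> coordinate_span"
  by (rule coordinate_span_cong[OF coordinate_in_span[of c "[]"]])
     (auto simp: group_like_fin_def group_like_def)

lemma linear_coordinate_functions_add:
  assumes "f \<in> linear_coordinate_functions" "g \<in> linear_coordinate_functions"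
  shows "(\<lambda>S. f S + g S) \<in> linear_coordinate_functions"
proof -
  obtain U a where f: "finite U" "f = (\<lambda>S. \<Sum>w\<in>U. a w * S w)"
    using assms(1) by (auto simp: linear_coordinate_functions_def)
  obtain V b where g: "finite V" "g = (\<lambda>S. \<Sum>w\<in>V. b w * S w)"
    using assms(2) by (auto simp: linear_coordinate_functions_def)
  define c where "c w = (if w \<in> U then a w else 0) + (if w \<in> V then b w else 0)" for w
  have "f S + g S = (\<Sum>w\<in>U \<union> V. c w * S w)" for S
  proof -
    have "f S = (\<Sum>w\<in>U \<union> V. (if w \<in> U then a w else 0) * S w)"
      unfolding f(2) using f(1) g(1) by (intro sum.mono_neutral_cong_left) auto
    moreover have "g S = (\<Sum>w\<in>U \<union> V. (if w \<in> V then b w else 0) * S w)"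
      unfolding g(2) using f(1) g(1) by (intro sum.mono_neutral_cong_left) auto
    ultimately show ?thesis by (simp add: c_def sum.distrib distrib_right)
  qed
  then show ?thesis
    using f(1) g(1) unfolding linear_coordinate_functions_def
    by (intro CollectI exI[of _ "U \<union> V"] exI[of _ c]) auto
qed

lemma coordinate_span_add:
  assumes "f \<in> coordinate_span" "g \<in> coordinate_span"
  shows "(\<lambda>S. f S + g S) \<in> coordinate_span"
proof -
  obtain f' g' where "f' \<in> linear_coordinate_functions" "\<forall>S\<in>group_like_fin. f S = f' S"
    "g' \<in> linear_coordinate_functions" "\<forall>S\<in>group_like_fin. g S = g' S"
    using assms by (auto simp: coordinate_span_def)
  then show ?thesis
    unfolding coordinate_span_def by (intro CollectI bexI[of _ "\<lambda>S. f' S + g' S"])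
      (auto intro: linear_coordinate_functions_add)
qed

lemma coordinate_span_sum:
  assumes "\<And>i. i \<in> I \<Longrightarrow> f i \<in> coordinate_span"
  shows "(\<lambda>S. \<Sum>i\<in>I. f i S) \<in> coordinate_span"
  using assms
  by (induction I rule: infinite_finite_induct) (auto intro: const_in_span coordinate_span_add)

lemma coordinate_span_sum_mset: "(\<lambda>S. c * (\<Sum>w\<in>#A. S w)) \<in> coordinate_span"
proof (induction A)
  case (add w A)
  then show ?case
    using coordinate_span_add[OF coordinate_in_span[of c w]] by (simp add: distrib_left)
qed (simp add: const_in_span)

lemma coordinate_span_mult:
  assumes "f \<in> coordinate_span" "g \<in> coordinate_span"
  shows "(\<lambda>S. f S * g S) \<in> coordinate_span"
proof -
  obtain U a where f: "\<And>S. S \<in> group_like_fin \<Longrightarrow> f S = (\<Sum>w\<in>U. a w * S w)"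
    using assms(1) by (auto simp: coordinate_span_def linear_coordinate_functions_def)
  obtain V b where g: "\<And>S. S \<in> group_like_fin \<Longrightarrow> g S = (\<Sum>w\<in>V. b w * S w)"
    using assms(2) by (auto simp: coordinate_span_def linear_coordinate_functions_def)
  show ?thesis
  proof (rule coordinate_span_cong)
    show "(\<lambda>S. \<Sum>u\<in>U. \<Sum>v\<in>V. a u * b v * (\<Sum>w\<in>#shuffle_product u v. S w)) \<in> coordinate_span"
      by (intro coordinate_span_sum coordinate_span_sum_mset)
    fix S :: "'a tensor_series" assume S: "S \<in> group_like_fin"
    have "f S * g S = (\<Sum>u\<in>U. \<Sum>v\<in>V. (a u * S u) * (b v * S v))"
      by (simp add: f[OF S] g[OF S] sum_product)
    also have "\<dots> = (\<Sum>u\<in>U. \<Sum>v\<in>V. a u * b v * (\<Sum>w\<in>#shuffle_product u v. S w))"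
      by (simp add: group_like_mult[OF group_like_fin_group_like[OF S], symmetric] mult_ac)
    finally show "f S * g S = (\<Sum>u\<in>U. \<Sum>v\<in>V. a u * b v * (\<Sum>w\<in>#shuffle_product u v. S w))" .
  qed
qed

lemma space_group_like_fin_borel: "space group_like_fin_borel = group_like_fin"
proof -
  have "U \<subseteq> group_like_fin" if "openin group_like_fin_topology U" for U :: "'a tensor_series set"
    using openin_subset[OF that]
    by (auto simp: group_like_fin_topology_def topology_generated_by_topspace)
  then show ?thesis unfolding group_like_fin_borel_def by (intro space_measure_of) auto
qed

section \<open>Moments of coordinates\<close>

text \<open>
A substitute for Minkowski's inequality for infinitely many summands: \<open>\<Sum>j. a j\<close> is at most the
supremum of \<open>2 ^ Suc j * a j\<close>, because the weights \<open>1 / 2 ^ Suc j\<close> sum to one.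
\<close>

lemma suminf_power_le_sum_power:
  fixes a :: "nat \<Rightarrow> real"
  assumes a: "\<And>j. a j \<ge> 0" and N: "N > 0" and s: "summable (\<lambda>j. (2 ^ Suc j * a j) ^ N)"
  shows "(\<Sum>j. a j) ^ N \<le> (\<Sum>j. (2 ^ Suc j * a j) ^ N)"
proof -
  define Y where "Y = (\<Sum>j. (2 ^ Suc j * a j) ^ N)"
  have le: "a j \<le> root N Y * (1 / 2) ^ Suc j" for j
  proof -
    have "(2 ^ Suc j * a j) ^ N = (\<Sum>i\<in>{j}. (2 ^ Suc i * a i) ^ N)" by simp
    also have "\<dots> \<le> Y"
      unfolding Y_def using s a by (intro sum_le_suminf) auto
    finally have "root N ((2 ^ Suc j * a j) ^ N) \<le> root N Y"
      using N by (intro real_root_le_mono)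
    then have "2 ^ Suc j * a j \<le> root N Y"
      using N a[of j] by (simp add: real_root_power_cancel)
    then show ?thesis by (simp add: field_simps power_one_over)
  qed
  have hs: "(\<lambda>j. root N Y * (1 / 2) ^ Suc j) sums (root N Y * 1)"
    by (intro sums_mult power_half_series)
  have sa: "summable a"
    using a le by (intro summable_comparison_test'[OF sums_summable[OF hs], of 0]) auto
  have "(\<Sum>j. a j) \<le> root N Y"
    using suminf_le[OF le sa sums_summable[OF hs]] sums_unique[OF hs] by simp
  moreover have "0 \<le> (\<Sum>j. a j)" using a by (rule suminf_nonneg[OF sa])
  ultimately have "(\<Sum>j. a j) ^ N \<le> root N Y ^ N" by (rule power_mono)
  also have "\<dots> = Y"
    using N a s by (intro real_root_pow_pos2) (auto simp: Y_def intro!: suminf_nonneg)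
  finally show ?thesis by (simp add: Y_def)
qed

text \<open>
A probability measure on \<open>group_like_fin\<close> whose expected tensor series has infinite radius of
convergence.
\<close>

locale convergent_expected_signature = prob_space M for M :: "'d::finite tensor_series measure" +
  assumes sets_M: "sets M = sets group_like_fin_borel"
    and integrable_levels: "integrable_levels M"
    and infinite_radius: "infinite_radius_of_convergence M"
begin

lemma space_M: "space M = group_like_fin"
  using sets_eq_imp_space_eq[OF sets_M] space_group_like_fin_borel by simp

lemma integrable_coordinate: "integrable M (\<lambda>S. S w)"
  using integrable_levels by (simp add: integrable_levels_def)

lemma measurable_coordinate [measurable]: "(\<lambda>S. S w) \<in> borel_measurable M"
  using integrable_coordinate by (rule borel_measurable_integrable)

lemma measurable_level_norm [measurable]: "level_norm k \<in> borel_measurable M"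
  unfolding level_norm_def by measurable

sublocale integrable_function_algebra M coordinate_span
proof
  show "integrable M f" if f: "f \<in> coordinate_span" for f
  proof -
    obtain W c where W: "finite W" "\<And>S. S \<in> group_like_fin \<Longrightarrow> f S = (\<Sum>w\<in>W. c w * S w)"
      using f by (auto simp: coordinate_span_def linear_coordinate_functions_def)
    have "integrable M (\<lambda>S. \<Sum>w\<in>W. c w * S w)"
      by (intro Bochner_Integration.integrable_sum integrable_mult_right integrable_coordinate)
    then show ?thesis
      by (subst Bochner_Integration.integrable_cong[OF refl, of _ _ "\<lambda>S. \<Sum>w\<in>W. c w * S w"])
         (auto simp: space_M W)
  qed
qed (auto intro: const_in_span coordinate_span_add coordinate_span_mult)

lemma integrable_coordinate_power: "integrable M (\<lambda>S. S w ^ n)"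
  using integrable_power_mem[OF coordinate_in_span[of 1 w]] by simp

lemma integral_sum_mset_coordinates:
  assumes "\<And>v. v \<in># A \<Longrightarrow> \<bar>LINT S|M. S v\<bar> \<le> c"
  shows "integrable M (\<lambda>S. \<Sum>v\<in>#A. S v) \<and> (LINT S|M. (\<Sum>v\<in>#A. S v)) \<le> real (size A) * c"
  using assms
proof (induction A)
  case (add x A)
  then have IH: "integrable M (\<lambda>S. \<Sum>v\<in>#A. S v)" "(LINT S|M. (\<Sum>v\<in>#A. S v)) \<le> real (size A) * c"
    and "\<bar>LINT S|M. S x\<bar> \<le> c" by auto
  then show ?case using integrable_coordinate[of x] by (simp add: distrib_right)
qed simp

lemma summable_expected_level_norm:
  "l > 0 \<Longrightarrow> summable (\<lambda>k. l ^ k * level_norm k (\<lambda>w. LINT S|M. S w))"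
proof -
  have "expected_level M k = level k (\<lambda>w. LINT S|M. S w)" for k
    by (auto simp: expected_level_def level_def)
  then show "l > 0 \<Longrightarrow> summable (\<lambda>k. l ^ k * level_norm k (\<lambda>w. LINT S|M. S w))"
    using infinite_radius by (simp add: infinite_radius_of_convergence_def projective_norm_level)
qed

text \<open>
A power of a coordinate of degree \<open>k\<close> is a sum of coordinates of degree \<open>N * k\<close>, whose expectations
decay faster than any exponential. Hence for fixed \<open>N\<close> the moments decay superexponentially in the
degree.
\<close>

lemma coordinate_moment_bound:
  assumes N: "N > 0" and r: "r > 0"
  shows "\<exists>C\<ge>0. \<forall>w. (LINT S|M. S w ^ N) \<le> C * r ^ length w"
proof -
  \<comment> \<open>chosen so that \<open>l ^ N\<close> outweighs both \<open>2 ^ N\<^sup>2\<close>, from the number of shuffles, and \<open>1 / r\<close>\<close>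
  define l where "l = 2 ^ N * max 1 (1 / r)"
  have l: "l > 0" by (simp add: l_def)
  have lN: "2 ^ N\<^sup>2 / l ^ N \<le> r"
  proof -
    have "1 / r \<le> max 1 (1 / r)" by simp
    also have "\<dots> = max 1 (1 / r) ^ 1" by simp
    also have "\<dots> \<le> max 1 (1 / r) ^ N" using N by (intro power_increasing) auto
    finally have "1 / max 1 (1 / r) ^ N \<le> 1 / (1 / r)" using r by (intro divide_left_mono) auto
    then show ?thesis
      by (simp add: l_def power_mult_distrib power2_eq_square power_mult)
  qed
  define E where "E = (\<lambda>w. LINT S|M. S w)"
  define C where "C = (\<Sum>k. l ^ k * level_norm k E)"
  have sm: "summable (\<lambda>k. l ^ k * level_norm k E)"
    using summable_expected_level_norm[OF l] by (simp add: E_def)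
  have C: "l ^ k * level_norm k E \<le> C" for k
    using sum_le_suminf[OF sm, of "{k}"] l by (simp add: C_def level_norm_nonneg)
  have C0: "C \<ge> 0" using sm l by (auto simp: C_def level_norm_nonneg intro!: suminf_nonneg)
  have "(LINT S|M. S w ^ N) \<le> C * r ^ length w" for w
  proof -
    have "(LINT S|M. S w ^ N) = (LINT S|M. (\<Sum>v\<in>#shuffle_power w N. S v))"
      by (intro Bochner_Integration.integral_cong refl group_like_power)
         (simp add: space_M group_like_fin_group_like)
    also have "\<dots> \<le> size (shuffle_power w N) * (C / l ^ (N * length w))"
    proof -
      have "\<bar>LINT S|M. S v\<bar> \<le> C / l ^ (N * length w)" if "v \<in># shuffle_power w N" for v
      proof -
        from that have v: "length v = N * length w" by (rule length_shuffle_power)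
      have "\<bar>LINT S|M. S v\<bar> \<le> level_norm (N * length w) E"
        using abs_le_level_norm[of E v] by (simp add: v E_def)
      also have "\<dots> \<le> C / l ^ (N * length w)"
        using C[of "N * length w"] l by (simp add: field_simps)
      finally show ?thesis .
      qed
      from integral_sum_mset_coordinates[OF this] show ?thesis by (rule conjunct2)
    qed
    also have "\<dots> \<le> (2 ^ N\<^sup>2) ^ length w * (C / l ^ (N * length w))"
    proof (rule mult_right_mono)
      have "real (size (shuffle_power w N)) \<le> real ((2 ^ N\<^sup>2) ^ length w)"
        using size_shuffle_power_le by (intro of_nat_mono)
      then show "real (size (shuffle_power w N)) \<le> (2 ^ N\<^sup>2) ^ length w" by simp
    qed (use C0 l in auto)
    also have "\<dots> = C * (2 ^ N\<^sup>2 / l ^ N) ^ length w"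
      by (simp add: power_divide power_mult)
    also have "\<dots> \<le> C * r ^ length w"
      using lN l C0 by (intro mult_left_mono power_mono) auto
    finally show ?thesis .
  qed
  with C0 show ?thesis by blast
qed

lemma level_norm_power_le:
  "level_norm k S ^ (2 * n) \<le> (real (CARD('d)) ^ k) ^ (2 * n) * (\<Sum>w\<in>words k. (S :: 'd tensor_series) w ^ (2 * n))"
proof -
  define m where "m = Max ((\<lambda>w. \<bar>S w\<bar>) ` words k)"
  have ne: "words k \<noteq> ({} :: 'd list set)"
    using card_words[where 'd = 'd and k = k] by (metis card.empty power_not_zero zero_less_card_finite less_irrefl)
  have m: "\<bar>S w\<bar> \<le> m" if "w \<in> words k" for w using that by (auto simp: m_def)
  have "m \<in> (\<lambda>w. \<bar>S w\<bar>) ` words k" unfolding m_def by (rule Max_in) (use ne in auto)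
  then obtain u where u: "u \<in> words k" "m = \<bar>S u\<bar>" by blast
  have "level_norm k S \<le> real (CARD('d)) ^ k * m"
    using sum_bounded_above[of "words k" "\<lambda>w. \<bar>S w\<bar>" m] m by (simp add: level_norm_def card_words)
  then have "level_norm k S ^ (2 * n) \<le> (real (CARD('d)) ^ k * m) ^ (2 * n)"
    by (rule power_mono) (rule level_norm_nonneg)
  also have "\<dots> = (real (CARD('d)) ^ k) ^ (2 * n) * S u ^ (2 * n)"
    by (simp add: power_mult_distrib u(2) power_even_abs)
  also have "\<dots> \<le> (real (CARD('d)) ^ k) ^ (2 * n) * (\<Sum>w\<in>words k. S w ^ (2 * n))"
    using u(1) by (intro mult_left_mono member_le_sum) auto
  finally show ?thesis .
qed

lemma integrable_level_norm_power: "integrable M (\<lambda>S. level_norm k S ^ (2 * n))"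
proof (rule Bochner_Integration.integrable_bound)
  show "integrable M (\<lambda>S. (real (CARD('d)) ^ k) ^ (2 * n) * (\<Sum>w\<in>words k. S w ^ (2 * n)))"
    by (intro integrable_mult_right Bochner_Integration.integrable_sum integrable_coordinate_power)
  show "AE S in M. norm (level_norm k S ^ (2 * n)) \<le>
     norm ((real (CARD('d)) ^ k) ^ (2 * n) * (\<Sum>w\<in>words k. S w ^ (2 * n)))"
    using level_norm_power_le by (intro AE_I2) (auto simp: power_even_abs intro: order_trans[OF _ abs_ge_self])
qed measurable

lemma level_norm_moment_bound:
  assumes n: "n > 0" and r: "r > 0"
  shows "\<exists>C. \<forall>k. (LINT S|M. level_norm k S ^ (2 * n)) \<le> C * r ^ k"
proof -
  define d where "d = real (CARD('d))"
  have d: "d > 0" by (simp add: d_def)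
  define q where "q = r / (d ^ (2 * n) * d)"
  have "2 * n > 0" "q > 0" using n r d by (auto simp: q_def)
  then obtain C where C: "C \<ge> 0" "\<And>w. (LINT S|M. S w ^ (2 * n)) \<le> C * q ^ length w"
    using coordinate_moment_bound by blast
  have "(LINT S|M. level_norm k S ^ (2 * n)) \<le> C * r ^ k" for k
  proof -
    have "(LINT S|M. level_norm k S ^ (2 * n)) \<le> (LINT S|M. (d ^ k) ^ (2 * n) * (\<Sum>w\<in>words k. S w ^ (2 * n)))"
      unfolding d_def
      by (intro integral_mono level_norm_power_le integrable_level_norm_power integrable_mult_right
          Bochner_Integration.integrable_sum integrable_coordinate_power)
    also have "\<dots> = (d ^ k) ^ (2 * n) * (\<Sum>w\<in>words k. LINT S|M. S w ^ (2 * n))"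
      using integrable_coordinate_power by (simp add: Bochner_Integration.integral_sum)
    also have "\<dots> \<le> (d ^ k) ^ (2 * n) * (\<Sum>w\<in>(words k :: 'd list set). C * q ^ k)"
      using C(2) d by (intro mult_left_mono sum_mono) (auto simp: words_iff)
    also have "\<dots> = C * (d ^ (2 * n) * d * q) ^ k"
      by (simp add: card_words d_def power_mult_distrib power_mult[symmetric] mult_ac)
    also have "d ^ (2 * n) * d * q = r" using d by (simp add: q_def)
    finally show ?thesis .
  qed
  then show ?thesis by blast
qed

end

section \<open>Convergence of series of coordinates\<close>

lemma summable_power_of_summable:
  fixes a :: "nat \<Rightarrow> real"
  assumes a: "\<And>j. a j \<ge> 0" and s: "summable a" and N: "N > 0"
  shows "summable (\<lambda>j. a j ^ N)"
proof -
  obtain n where n: "N = Suc n" using N by (cases N) auto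
  define A where "A = (\<Sum>j. a j)"
  have A: "a j \<le> A" for j
    using sum_le_suminf[OF s, of "{j}"] a by (simp add: A_def)
  have "summable (\<lambda>j. A ^ n * a j)" using s by (rule summable_mult)
  then show ?thesis
  proof (rule summable_comparison_test'[where N = 0])
    fix j
    show "norm (a j ^ N) \<le> A ^ n * a j"
      using a[of j] A[of j] by (auto simp: n intro!: mult_right_mono power_mono simp: mult.commute[of "a j"])
  qed
qed

lemma abs_word_sum_le:
  assumes c: "\<And>v. \<bar>c v\<bar> \<le> b ^ length v"
  shows "\<bar>\<Sum>v\<in>words j. c v * S v\<bar> \<le> b ^ j * level_norm j S"
proof -
  have "\<bar>\<Sum>v\<in>words j. c v * S v\<bar> \<le> (\<Sum>v\<in>words j. \<bar>c v\<bar> * \<bar>S v\<bar>)"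
    by (rule order_trans[OF sum_abs]) (simp add: abs_mult)
  also have "\<dots> \<le> (\<Sum>v\<in>words j. b ^ j * \<bar>S v\<bar>)"
  proof (intro sum_mono mult_right_mono)
    fix v :: "'a list" assume "v \<in> words j"
    then show "\<bar>c v\<bar> \<le> b ^ j" using c[of v] by (simp add: words_iff)
  qed simp
  finally show ?thesis by (simp add: level_norm_def sum_distrib_left)
qed

context convergent_expected_signature
begin

text \<open>
The superexponential decay of moments makes a series of coordinates with exponentially growing
coefficients converge in every \<open>L^q\<close> with \<open>q\<close> even. Thus its sum is approximable once it is bounded.
\<close>

lemma approximable_word_series:
  assumes b: "b > 0" and c: "\<And>v. \<bar>c v\<bar> \<le> b ^ length v"
    and B: "\<And>S. S \<in> group_like_fin \<Longrightarrow> \<bar>\<Sum>j. \<Sum>v\<in>words j. c v * S v\<bar> \<le> B"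
  shows "approximable (\<lambda>S. \<Sum>j. \<Sum>v\<in>words j. c v * S v)"
  unfolding approximable_def
proof (intro conjI allI impI)
  define x where "x j S = (\<Sum>v\<in>words j. c v * S v)" for j and S :: "'d tensor_series"
  define F where "F S = (\<Sum>j. x j S)" for S
  define P where "P K S = (\<Sum>j<K. x j S)" for K S
  have x_meas [measurable]: "x j \<in> borel_measurable M" for j
    unfolding x_def by measurable
  have [measurable]: "F \<in> borel_measurable M" "P K \<in> borel_measurable M" for K
    unfolding F_def P_def by measurable
  have F_eq: "(\<lambda>S. \<Sum>j. \<Sum>v\<in>words j. c v * S v) = F" by (rule ext) (simp add: F_def x_def)
  show "bounded_measurable (\<lambda>S. \<Sum>j. \<Sum>v\<in>words j. c v * S v)"
    unfolding bounded_measurable_def using B by (auto simp: F_eq space_M)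
  fix n :: nat and e :: real assume n: "n > 0" and e: "e > 0"
  define a where "a j S = b ^ j * level_norm j S" for j and S :: "'d tensor_series"
  have a0: "a j S \<ge> 0" for j S using b by (simp add: a_def level_norm_nonneg)
  have xa: "\<bar>x j S\<bar> \<le> a j S" for j S
    unfolding x_def a_def by (rule abs_word_sum_le[OF c])
  have sa: "summable (\<lambda>j. a j S)" if "S \<in> group_like_fin" for S
    using group_like_fin_summable[OF that, of b] b by (simp add: a_def)
  have sx: "summable (\<lambda>j. \<bar>x j S\<bar>)" if "S \<in> group_like_fin" for S
    by (rule summable_comparison_test'[where N = 0, OF sa[OF that]]) (simp add: xa)
  define y where "y j S = (2 ^ Suc j * a j S) ^ (2 * n)" for j S
  have y_eq: "y j S = (2 * (2 * b) ^ j) ^ (2 * n) * level_norm j S ^ (2 * n)" for j S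
    by (simp add: y_def a_def power_mult_distrib mult_ac)
  have y0: "y j S \<ge> 0" for j S unfolding y_def by (rule zero_le_even_power')
  have sy: "summable (\<lambda>j. y j S)" if S: "S \<in> group_like_fin" for S
  proof -
    have "summable (\<lambda>j. 2 * ((2 * b) ^ j * level_norm j S))"
      using group_like_fin_summable[OF S, of "2 * b"] b by (intro summable_mult) auto
    then have "summable (\<lambda>j. 2 ^ Suc j * a j S)"
      by (simp add: a_def power_mult_distrib mult_ac)
    then show ?thesis
      unfolding y_def using n by (intro summable_power_of_summable mult_nonneg_nonneg a0) auto
  qed
  \<comment> \<open>an integrable majorant for the errors of all partial sums\<close>
  define H where "H S = (\<Sum>j. y j S)" for S
  have iH: "integrable M H"
    unfolding H_def
  proof (rule integrable_suminf)
    show "integrable M (y j)" for j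
      unfolding y_eq by (intro integrable_mult_right integrable_level_norm_power)
    show "AE S in M. summable (\<lambda>j. norm (y j S))"
      using sy y0 by (intro AE_I2) (simp add: space_M)
    \<comment> \<open>this decay rate compensates the growth of the coefficients up to a factor \<open>1 / 2\<close>\<close>
    define q where "q = 1 / (2 * (2 * b) ^ (2 * n))"
    have q: "q > 0" using b by (simp add: q_def)
    then obtain C where C: "\<And>k. (LINT S|M. level_norm k S ^ (2 * n)) \<le> C * q ^ k"
      using level_norm_moment_bound[OF n] by blast
    show "summable (\<lambda>j. LINT S|M. norm (y j S))"
    proof (rule summable_comparison_test'[where N = 0])
      show "summable (\<lambda>j. 2 ^ (2 * n) * C * (1 / 2) ^ j)"
        by (intro summable_mult summable_geometric) simp
      fix j
      have "norm (LINT S|M. norm (y j S)) = (LINT S|M. y j S)"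
        using y0 by (simp add: Bochner_Integration.integral_nonneg)
      also have "\<dots> = (2 * (2 * b) ^ j) ^ (2 * n) * (LINT S|M. level_norm j S ^ (2 * n))"
        by (simp add: y_eq)
      also have "\<dots> \<le> (2 * (2 * b) ^ j) ^ (2 * n) * (C * q ^ j)"
        using C by (intro mult_left_mono zero_le_even_power')
      also have "\<dots> = 2 ^ (2 * n) * C * ((2 * b) ^ (2 * n) * q) ^ j"
        by (simp add: power_mult_distrib power_mult[symmetric] mult_ac)
      also have "(2 * b) ^ (2 * n) * q = 1 / 2" using b by (simp add: q_def)
      finally show "norm (LINT S|M. norm (y j S)) \<le> 2 ^ (2 * n) * C * (1 / 2) ^ j" .
    qed
  qed
  have P_lim: "(\<lambda>K. P K S) \<longlonglongrightarrow> F S" if "S \<in> group_like_fin" for S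
    unfolding P_def F_def using sx[OF that] by (intro summable_LIMSEQ) (rule summable_rabs_cancel)
  have dom: "(F S - P K S) ^ (2 * n) \<le> H S" if S: "S \<in> group_like_fin" for S K
  proof -
    have "F S - P K S = (\<Sum>j. x (j + K) S)"
      using suminf_minus_initial_segment[OF summable_rabs_cancel[OF sx[OF S]], of K]
      by (simp add: F_def P_def)
    then have "\<bar>F S - P K S\<bar> \<le> (\<Sum>j. \<bar>x (j + K) S\<bar>)"
      using summable_rabs[OF summable_ignore_initial_segment[OF sx[OF S], of K]] by simp
    also have "\<dots> \<le> (\<Sum>j. a (j + K) S)"
      by (intro suminf_le xa summable_ignore_initial_segment sx[OF S] sa[OF S])
    also have "\<dots> = (\<Sum>j. a j S) - (\<Sum>j<K. a j S)"
      by (rule suminf_minus_initial_segment[OF sa[OF S]])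
    also have "\<dots> \<le> (\<Sum>j. a j S)" using a0 by (simp add: sum_nonneg)
    finally have "\<bar>F S - P K S\<bar> ^ (2 * n) \<le> (\<Sum>j. a j S) ^ (2 * n)" by (intro power_mono) auto
    also have "\<dots> \<le> H S"
      unfolding H_def y_def using n sy[OF S] by (intro suminf_power_le_sum_power a0) (auto simp: y_def)
    finally show ?thesis by (simp add: power_even_abs)
  qed
  have "(\<lambda>K. LINT S|M. (F S - P K S) ^ (2 * n)) \<longlonglongrightarrow> (LINT S|M. 0)"
  proof (rule integral_dominated_convergence[where w = H])
    show "AE S in M. (\<lambda>K. (F S - P K S) ^ (2 * n)) \<longlonglongrightarrow> 0"
    proof (rule AE_I2)
      fix S assume "S \<in> space M"
      then have "(\<lambda>K. (F S - P K S) ^ (2 * n)) \<longlonglongrightarrow> (F S - F S) ^ (2 * n)"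
        by (intro tendsto_intros P_lim) (simp add: space_M)
      then show "(\<lambda>K. (F S - P K S) ^ (2 * n)) \<longlonglongrightarrow> 0" using n by (simp add: zero_power)
    qed
    show "AE S in M. norm ((F S - P K S) ^ (2 * n)) \<le> H S" for K
      using dom by (intro AE_I2) (simp add: space_M power_even_abs)
  qed (auto intro: iH)
  then have "eventually (\<lambda>K. (LINT S|M. (F S - P K S) ^ (2 * n)) < e) sequentially"
    using e by (intro order_tendstoD) auto
  then obtain K where K: "(LINT S|M. (F S - P K S) ^ (2 * n)) < e"
    by (auto simp: eventually_sequentially)
  have "P K \<in> coordinate_span"
    unfolding P_def x_def by (intro coordinate_span_sum coordinate_in_span)
  then show "\<exists>g\<in>coordinate_span. (LINT S|M. ((\<Sum>j. \<Sum>v\<in>words j. c v * S v) - g S) ^ (2 * n)) < e"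
    using K by (intro bexI[of _ "P K"]) (simp_all add: F_def x_def)
qed

end

section \<open>Orthogonal representations\<close>

text \<open>
The adjoint of the shuffle product: the sum of \<open>f u v\<close> over all ways of distributing the letters
of a word over two complementary subwords \<open>u\<close> and \<open>v\<close>.
\<close>

fun unshuffle_sum :: "'a list \<Rightarrow> ('a list \<Rightarrow> 'a list \<Rightarrow> real) \<Rightarrow> real" where
  "unshuffle_sum [] f = f [] []"
| "unshuffle_sum (a # w) f = unshuffle_sum w (\<lambda>u v. f (a # u) v) + unshuffle_sum w (\<lambda>u v. f u (a # v))"

lemma unshuffle_sum_add:
  "unshuffle_sum w (\<lambda>u v. f u v + g u v) = unshuffle_sum w f + unshuffle_sum w g"
  by (induction w arbitrary: f g) auto

lemma unshuffle_sum_zero: "unshuffle_sum w (\<lambda>u v. 0) = 0"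
  by (induction w) auto

text \<open>
The pairing of \<open>f\<close>, restricted to words of lengths \<open>i\<close> and \<open>j\<close>, with the coproduct of \<open>S\<close>.
\<close>

definition shuffle_form ::
  "('d::finite list \<Rightarrow> real) \<Rightarrow> ('d list \<Rightarrow> 'd list \<Rightarrow> real) \<Rightarrow> nat \<Rightarrow> nat \<Rightarrow> real" where
  "shuffle_form S f i j =
     (\<Sum>u\<in>words i. \<Sum>v\<in>words j. f u v * (\<Sum>w\<in>#shuffle_product u v. S w))"

lemma shuffle_product_Nil2: "shuffle_product u [] = {#u#}"
  by (cases u) auto

lemma shuffle_form_Suc_Suc:
  "shuffle_form S f (Suc i) (Suc j) =
     (\<Sum>a\<in>UNIV. shuffle_form (\<lambda>w. S (a # w)) (\<lambda>u v. f (a # u) v) i (Suc j)) +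
     (\<Sum>a\<in>UNIV. shuffle_form (\<lambda>w. S (a # w)) (\<lambda>u v. f u (a # v)) (Suc i) j)"
proof -
  have "shuffle_form S f (Suc i) (Suc j) =
    (\<Sum>a\<in>UNIV. \<Sum>u\<in>words i. \<Sum>b\<in>UNIV. \<Sum>v\<in>words j.
        f (a # u) (b # v) * (\<Sum>w\<in>#shuffle_product u (b # v). S (a # w))) +
    (\<Sum>a\<in>UNIV. \<Sum>u\<in>words i. \<Sum>b\<in>UNIV. \<Sum>v\<in>words j.
        f (a # u) (b # v) * (\<Sum>w\<in>#shuffle_product (a # u) v. S (b # w)))"
    by (simp add: shuffle_form_def sum_words_Suc distrib_left sum.distrib multiset.map_comp comp_def)
  also have "(\<Sum>a\<in>UNIV. \<Sum>u\<in>words i. \<Sum>b\<in>UNIV. \<Sum>v\<in>words j.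
        f (a # u) (b # v) * (\<Sum>w\<in>#shuffle_product (a # u) v. S (b # w))) =
    (\<Sum>b\<in>UNIV. \<Sum>a\<in>UNIV. \<Sum>u\<in>words i. \<Sum>v\<in>words j.
        f (a # u) (b # v) * (\<Sum>w\<in>#shuffle_product (a # u) v. S (b # w)))"
    by (subst (2) sum.swap, rule sum.cong[OF refl]) (rule sum.swap)
  finally show ?thesis by (simp add: shuffle_form_def sum_words_Suc)
qed

lemma shuffle_form_0_Suc:
  "shuffle_form S f 0 (Suc j) = (\<Sum>a\<in>UNIV. shuffle_form (\<lambda>w. S (a # w)) (\<lambda>u v. f u (a # v)) 0 j)"
  by (simp add: shuffle_form_def sum_words_Suc words_0)

lemma shuffle_form_Suc_0:
  "shuffle_form S f (Suc i) 0 = (\<Sum>a\<in>UNIV. shuffle_form (\<lambda>w. S (a # w)) (\<lambda>u v. f (a # u) v) i 0)"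
  by (simp add: shuffle_form_def sum_words_Suc words_0 shuffle_product_Nil2)

text \<open>
Duality between shuffling and unshuffling, by recursion on the first letter of the shuffled word.
\<close>

lemma sum_shuffle_form:
  "(\<Sum>i\<le>n. shuffle_form S f i (n - i)) = (\<Sum>w\<in>words n. S w * unshuffle_sum w f)"
proof (induction n arbitrary: S f)
  case 0
  show ?case by (simp add: shuffle_form_def words_0)
next
  case (Suc n)
  define A where "A i j = (\<Sum>a\<in>UNIV. shuffle_form (\<lambda>w. S (a # w)) (\<lambda>u v. f (a # u) v) i j)" for i j
  define B where "B i j = (\<Sum>a\<in>UNIV. shuffle_form (\<lambda>w. S (a # w)) (\<lambda>u v. f u (a # v)) i j)" for i j
  have step: "shuffle_form S f i (Suc n - i) =
      (if 0 < i then A (i - 1) (Suc n - i) else 0) + (if i < Suc n then B i (n - i) else 0)"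
    if "i \<le> Suc n" for i
  proof (cases i)
    case 0
    then show ?thesis by (simp add: shuffle_form_0_Suc B_def)
  next
    case (Suc i')
    show ?thesis
    proof (cases "i = Suc n")
      case True
      then show ?thesis by (simp add: shuffle_form_Suc_0 A_def)
    next
      case False
      then have "Suc n - i = Suc (n - i)" "i < Suc n" using that by auto
      then show ?thesis using Suc by (simp add: shuffle_form_Suc_Suc A_def B_def)
    qed
  qed
  have "(\<Sum>i\<le>Suc n. shuffle_form S f i (Suc n - i)) =
      (\<Sum>i\<le>Suc n. if 0 < i then A (i - 1) (Suc n - i) else 0) +
      (\<Sum>i\<le>Suc n. if i < Suc n then B i (n - i) else 0)"
    unfolding sum.distrib[symmetric] by (intro sum.cong refl step) simp
  also have "(\<Sum>i\<le>Suc n. if 0 < i then A (i - 1) (Suc n - i) else 0) = (\<Sum>i\<le>n. A i (n - i))"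
    by (subst sum.atMost_Suc_shift) simp
  also have "(\<Sum>i\<le>Suc n. if i < Suc n then B i (n - i) else 0) = (\<Sum>i\<le>n. B i (n - i))"
    by (simp add: sum.atMost_Suc)
  also have "(\<Sum>i\<le>n. A i (n - i)) =
      (\<Sum>a\<in>UNIV. \<Sum>w\<in>words n. S (a # w) * unshuffle_sum w (\<lambda>u v. f (a # u) v))"
    unfolding A_def by (subst sum.swap) (simp add: Suc.IH)
  also have "(\<Sum>i\<le>n. B i (n - i)) =
      (\<Sum>a\<in>UNIV. \<Sum>w\<in>words n. S (a # w) * unshuffle_sum w (\<lambda>u v. f u (a # v)))"
    unfolding B_def by (subst sum.swap) (simp add: Suc.IH)
  finally show ?case by (simp add: sum_words_Suc distrib_left sum.distrib)
qed

text \<open>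
Let \<open>k\<close> be the length of \<open>w\<close>. Index the standard basis of a space of dimension \<open>k + 1\<close> by \<open>0, ..., k\<close>
and attach to the letter \<open>a\<close> the skew-symmetric matrix \<open>A a\<close> with entry \<open>1\<close> at \<open>(i, i + 1)\<close> and \<open>-1\<close> at
\<open>(i + 1, i)\<close> for every position \<open>i\<close> at which \<open>w\<close> has the letter \<open>a\<close>. Then \<open>zigzag w v i\<close> is the entry
at \<open>(i, k)\<close> of the product of these matrices along the word \<open>v\<close>. It vanishes for \<open>i\<close> beyond \<open>k\<close>.
\<close>

fun zigzag :: "'a list \<Rightarrow> 'a list \<Rightarrow> nat \<Rightarrow> real" where
  "zigzag w [] i = (if i = length w then 1 else 0)"
| "zigzag w (a # v) i =
     (if i < length w \<and> w ! i = a then zigzag w v (Suc i) else 0) -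
     (if 0 < i \<and> i \<le> length w \<and> w ! (i - 1) = a then zigzag w v (i - 1) else 0)"

lemma abs_zigzag_le: "\<bar>zigzag w v i\<bar> \<le> 2 ^ length v"
proof (induction v arbitrary: i)
  case (Cons a v)
  have "\<bar>zigzag w (a # v) i\<bar> \<le> \<bar>zigzag w v (Suc i)\<bar> + \<bar>zigzag w v (i - 1)\<bar>" by auto
  also have "\<dots> \<le> 2 ^ length v + 2 ^ length v" by (intro add_mono Cons.IH)
  finally show ?case by simp
qed simp

text \<open>
Each letter moves the index by one, so the only word of length at most \<open>length w - i\<close> leading
from \<open>i\<close> to \<open>length w\<close> is the one that spells out the remaining letters of \<open>w\<close>.
\<close>

lemma zigzag_short:
  "i \<le> length w \<Longrightarrow> length v \<le> length w - i \<Longrightarrow> zigzag w v i = (if v = drop i w then 1 else 0)"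
proof (induction v arbitrary: i)
  case (Cons a v)
  then have i: "i < length w" by simp
  have up: "zigzag w v (Suc i) = (if v = drop (Suc i) w then 1 else 0)"
    using Cons.prems i by (intro Cons.IH) auto
  have "zigzag w v (i - 1) = 0" if "0 < i"
  proof -
    have "zigzag w v (i - 1) = (if v = drop (i - 1) w then 1 else 0)"
      using Cons.prems i by (intro Cons.IH) auto
    moreover have "v \<noteq> drop (i - 1) w" using Cons.prems that by (auto simp: length_drop)
    ultimately show ?thesis by simp
  qed
  moreover have "drop i w = w ! i # drop (Suc i) w" using i by (rule Cons_nth_drop_Suc[symmetric])
  ultimately show ?case using i up by auto
qed auto

lemma zigzag_skew:
  "(\<Sum>i\<le>length w. zigzag w (a # u) i * zigzag w v i + zigzag w u i * zigzag w (a # v) i) = 0"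
proof -
  define k where "k = length w"
  define p :: "nat \<Rightarrow> real" where "p i = (if w ! i = a then 1 else 0)" for i
  define g h where "g = zigzag w u" and "h = zigzag w v"
  have "zigzag w (a # u) i * h i + g i * zigzag w (a # v) i =
      (if i < k then p i * (g (Suc i) * h i + g i * h (Suc i)) else 0) -
      (if 0 < i then p (i - 1) * (g (i - 1) * h i + g i * h (i - 1)) else 0)" if "i \<le> k" for i
    using that by (simp add: k_def p_def g_def h_def algebra_simps)
  then have "(\<Sum>i\<le>k. zigzag w (a # u) i * h i + g i * zigzag w (a # v) i) =
      (\<Sum>i\<le>k. if i < k then p i * (g (Suc i) * h i + g i * h (Suc i)) else 0) -
      (\<Sum>i\<le>k. if 0 < i then p (i - 1) * (g (i - 1) * h i + g i * h (i - 1)) else 0)"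
    unfolding sum_subtractf[symmetric] by (intro sum.cong) auto
  also have "(\<Sum>i\<le>k. if i < k then p i * (g (Suc i) * h i + g i * h (Suc i)) else 0) =
      (\<Sum>i<k. p i * (g (Suc i) * h i + g i * h (Suc i)))"
    by (rule sum.mono_neutral_cong_right) auto
  also have "(\<Sum>i\<le>k. if 0 < i then p (i - 1) * (g (i - 1) * h i + g i * h (i - 1)) else 0) =
      (\<Sum>i<k. p i * (g (Suc i) * h i + g i * h (Suc i)))"
    by (subst sum.atMost_shift) (simp add: algebra_simps)
  finally show ?thesis by (simp add: k_def g_def h_def)
qed

text \<open>
The entry at \<open>(i, length w)\<close> of the matrix to which \<open>S\<close> is sent when the letter \<open>a\<close> is represented by
\<open>t\<close> times its skew-symmetric matrix.
\<close>

definition zigzag_coordinate :: "'d::finite list \<Rightarrow> nat \<Rightarrow> real \<Rightarrow> 'd tensor_series \<Rightarrow> real" where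
  "zigzag_coordinate w i t S = (\<Sum>j. \<Sum>v\<in>words j. t ^ length v * zigzag w v i * S v)"

lemma abs_zigzag_sum_le:
  "\<bar>\<Sum>v\<in>words j. zigzag w v i * S v\<bar> \<le> 2 ^ j * level_norm j S"
  by (rule abs_word_sum_le[OF abs_zigzag_le])

lemma zigzag_coordinate_powser:
  "zigzag_coordinate w i t S = (\<Sum>j. (\<Sum>v\<in>words j. zigzag w v i * S v) * t ^ j)"
proof -
  have "(\<Sum>v\<in>words j. t ^ length v * zigzag w v i * S v) = (\<Sum>v\<in>words j. zigzag w v i * S v) * t ^ j" for j
    unfolding sum_distrib_right by (intro sum.cong refl) (simp add: words_iff)
  then show ?thesis by (simp add: zigzag_coordinate_def)
qed

lemma summable_zigzag:
  assumes S: "S \<in> group_like_fin"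
  shows "summable (\<lambda>j. \<bar>(\<Sum>v\<in>words j. zigzag w v i * S v) * t ^ j\<bar>)"
proof (rule summable_comparison_test'[where N = 0])
  show "summable (\<lambda>j. (2 * \<bar>t\<bar>) ^ j * level_norm j S)"
    using S by (rule group_like_fin_summable) simp
  show "norm \<bar>(\<Sum>v\<in>words j. zigzag w v i * S v) * t ^ j\<bar> \<le> (2 * \<bar>t\<bar>) ^ j * level_norm j S" for j
    using mult_right_mono[OF abs_zigzag_sum_le[of w i S j], of "\<bar>t\<bar> ^ j"]
    by (simp add: abs_mult power_abs power_mult_distrib mult_ac)
qed

text \<open>
A group-like element is sent to an orthogonal matrix: by the shuffle identity the squared length of
its last column is a series in the coordinates of \<open>S\<close>, and skew-symmetry cancels the coefficients
of all nonempty words.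
\<close>

lemma sum_zigzag_coordinate_squares:
  assumes S: "S \<in> group_like_fin"
  shows "(\<Sum>i\<le>length w. (zigzag_coordinate w i t S)\<^sup>2) = 1"
proof -
  define x where "x i j = (\<Sum>v\<in>words j. zigzag w v i * S v) * t ^ j" for i j
  define f where "f u v = (\<Sum>i\<le>length w. zigzag w u i * zigzag w v i)" for u v
  have Sg: "S \<in> group_like" using S by (rule group_like_fin_group_like)
  have f_skew: "f (a # u) v + f u (a # v) = 0" for a u v
    using zigzag_skew[of w a u v] by (simp add: f_def sum.distrib)
  have f_unshuffle: "unshuffle_sum v f = (if v = [] then 1 else 0)" for v
  proof (cases v)
    case (Cons a v')
    have "unshuffle_sum v f = unshuffle_sum v' (\<lambda>u v. f (a # u) v + f u (a # v))"
      by (simp add: Cons unshuffle_sum_add)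
    then show ?thesis using Cons by (simp add: f_skew unshuffle_sum_zero)
  qed (simp add: f_def if_distrib cong: if_cong)
  have prod: "(\<lambda>n. \<Sum>j\<le>n. x i j * x i (n - j)) sums ((zigzag_coordinate w i t S)\<^sup>2)" for i
    using Cauchy_product_sums[of "x i" "x i"] summable_zigzag[OF S, of w i t]
    by (simp add: x_def zigzag_coordinate_powser power2_eq_square)
  have coeff: "(\<Sum>i\<le>length w. \<Sum>j\<le>n. x i j * x i (n - j)) = (if n = 0 then 1 else 0)" for n
  proof -
    have "(\<Sum>i\<le>length w. x i j * x i (n - j)) = t ^ n * shuffle_form S f j (n - j)" if "j \<le> n" for j
    proof -
      have "(\<Sum>i\<le>length w. x i j * x i (n - j)) =
          (\<Sum>i\<le>length w. \<Sum>u\<in>words j. \<Sum>v\<in>words (n - j). t ^ n * (zigzag w u i * zigzag w v i * (S u * S v)))"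
      proof (intro sum.cong refl)
        fix i
        have "t ^ j * t ^ (n - j) = t ^ n" using that by (simp add: power_add[symmetric])
        then have "x i j * x i (n - j) =
            t ^ n * ((\<Sum>u\<in>words j. zigzag w u i * S u) * (\<Sum>v\<in>words (n - j). zigzag w v i * S v))"
          by (simp add: x_def mult_ac)
        also have "\<dots> = (\<Sum>u\<in>words j. \<Sum>v\<in>words (n - j). t ^ n * ((zigzag w u i * S u) * (zigzag w v i * S v)))"
          by (subst sum_product) (simp only: sum_distrib_left)
        finally show "x i j * x i (n - j) =
            (\<Sum>u\<in>words j. \<Sum>v\<in>words (n - j). t ^ n * (zigzag w u i * zigzag w v i * (S u * S v)))"
          by (simp only: mult_ac)
      qed
      also have "\<dots> = (\<Sum>u\<in>words j. \<Sum>v\<in>words (n - j). \<Sum>i\<le>length w. t ^ n * (zigzag w u i * zigzag w v i * (S u * S v)))"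
        by (subst sum.swap, rule sum.cong[OF refl]) (rule sum.swap)
      also have "\<dots> = t ^ n * shuffle_form S f j (n - j)"
        by (simp add: shuffle_form_def f_def group_like_mult[OF Sg] sum_distrib_left sum_distrib_right)
      finally show ?thesis .
    qed
    then have "(\<Sum>i\<le>length w. \<Sum>j\<le>n. x i j * x i (n - j)) = (\<Sum>j\<le>n. t ^ n * shuffle_form S f j (n - j))"
      by (subst sum.swap) simp
    also have "\<dots> = t ^ n * (\<Sum>v\<in>words n. S v * unshuffle_sum v f)"
      by (simp add: sum_distrib_left[symmetric] sum_shuffle_form)
    also have "\<dots> = (if n = 0 then 1 else 0)"
      using Sg by (auto simp: f_unshuffle words_0 group_like_def words_iff intro!: sum.neutral)
    finally show ?thesis .
  qed
  have "(\<lambda>n. \<Sum>i\<le>length w. \<Sum>j\<le>n. x i j * x i (n - j)) sums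
      (\<Sum>i\<le>length w. (zigzag_coordinate w i t S)\<^sup>2)"
    by (intro sums_sum prod)
  moreover have "(\<lambda>n. if n = 0 then 1 else 0 :: real) sums 1"
    using sums_single[of 0 "\<lambda>_. 1 :: real"] by simp
  ultimately show ?thesis unfolding coeff using sums_unique2 by blast
qed

lemma abs_zigzag_coordinate_le:
  assumes "S \<in> group_like_fin"
  shows "\<bar>zigzag_coordinate w 0 t S\<bar> \<le> 1"
proof -
  have "(zigzag_coordinate w 0 t S)\<^sup>2 \<le> (\<Sum>i\<le>length w. (zigzag_coordinate w i t S)\<^sup>2)"
    by (rule member_le_sum) auto
  then show ?thesis using sum_zigzag_coordinate_squares[OF assms, of w t] by (simp add: abs_square_le_1)
qed

text \<open>
Among the words of length at most \<open>length w\<close>, only \<open>w\<close> leads from \<open>0\<close> to \<open>length w\<close>. So the power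
series \<open>zigzag_coordinate w 0 t S\<close> in \<open>t\<close> starts with \<open>S w * t ^ length w\<close>.
\<close>

lemma zigzag_coordinate_limit:
  assumes S: "S \<in> group_like_fin"
  shows "(\<lambda>n. real (Suc n) ^ length w * zigzag_coordinate w 0 (1 / real (Suc n)) S) \<longlonglongrightarrow> S w"
proof -
  define k where "k = length w"
  define y where "y j = (\<Sum>v\<in>words j. zigzag w v 0 * S v)" for j
  have y: "y j = (if j = k then S w else 0)" if "j \<le> k" for j
  proof -
    have "y j = (\<Sum>v\<in>words j. (if v = w then 1 else 0) * S v)"
      unfolding y_def using that by (intro sum.cong refl) (auto simp: words_iff k_def zigzag_short)
    also have "\<dots> = (\<Sum>v\<in>words j. if v = w then S w else 0)"
      by (intro sum.cong) auto
    also have "\<dots> = (if j = k then S w else 0)" by (auto simp: words_iff k_def)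
    finally show ?thesis .
  qed
  have sm: "summable (\<lambda>j. y j * t ^ j)" for t
    using summable_zigzag[OF S, of w 0 t] unfolding y_def by (rule summable_rabs_cancel)
  have shift: "summable (\<lambda>m. y (m + k) * t ^ m) \<and>
      zigzag_coordinate w 0 t S = t ^ k * (\<Sum>m. y (m + k) * t ^ m)" for t
  proof -
    have s1: "summable (\<lambda>m. y (m + k) * t ^ m)"
    proof (cases "t = 0")
      case True
      then show ?thesis by (intro summable_finite[of "{0}"]) auto
    next
      case False
      have "summable (\<lambda>m. (y (m + k) * t ^ (m + k)) * (1 / t ^ k))"
        by (intro summable_mult2 summable_ignore_initial_segment sm)
      then show ?thesis using False by (simp add: power_add)
    qed
    have "zigzag_coordinate w 0 t S = (\<Sum>m. y (m + k) * t ^ (m + k)) + (\<Sum>j<k. y j * t ^ j)"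
      using suminf_split_initial_segment[OF sm, of t k] by (simp add: zigzag_coordinate_powser y_def)
    also have "(\<Sum>j<k. y j * t ^ j) = 0" by (intro sum.neutral) (simp add: y)
    also have "(\<Sum>m. y (m + k) * t ^ (m + k)) = t ^ k * (\<Sum>m. y (m + k) * t ^ m)"
      using suminf_mult[OF s1, of "t ^ k"] by (simp add: power_add mult_ac)
    finally show ?thesis using s1 by simp
  qed
  have "((\<lambda>t. \<Sum>m. y (m + k) * t ^ m) \<longlongrightarrow> y (0 + k)) (at 0)"
    using shift by (intro powser_limit_0[of 1]) (auto intro: summable_sums)
  moreover have "filterlim (\<lambda>n. 1 / real (Suc n)) (at 0) sequentially"
    unfolding filterlim_at
  proof
    show "(\<lambda>n. 1 / real (Suc n)) \<longlonglongrightarrow> 0" by (rule LIMSEQ_Suc) (rule lim_1_over_n)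
  qed simp
  ultimately have "(\<lambda>n. \<Sum>m. y (m + k) * (1 / real (Suc n)) ^ m) \<longlonglongrightarrow> y (0 + k)"
    by (rule filterlim_compose)
  moreover have "(\<Sum>m. y (m + k) * (1 / real (Suc n)) ^ m) =
      real (Suc n) ^ length w * zigzag_coordinate w 0 (1 / real (Suc n)) S" for n
  proof -
    have "real (Suc n) ^ k * (1 / real (Suc n)) ^ k = 1"
      unfolding power_mult_distrib[symmetric] by simp
    then show ?thesis
      unfolding conjunct2[OF shift[of "1 / real (Suc n)"]] k_def[symmetric]
      by (simp only: mult.assoc[symmetric] mult_1_left)
  qed
  ultimately show ?thesis using y[of k] by simp
qed

section \<open>The Borel sets\<close>

text \<open>
Finiteness of all the norms \<open>weighted_norm l\<close>, without the group-like condition.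
\<close>

definition rapidly_decaying :: "'d::finite tensor_series \<Rightarrow> bool" where
  "rapidly_decaying S \<longleftrightarrow> (\<forall>l>0. summable (\<lambda>k. l ^ k * level_norm k S))"

lemma group_like_fin_rapidly_decaying: "S \<in> group_like_fin \<Longrightarrow> rapidly_decaying S"
  by (simp add: rapidly_decaying_def group_like_fin_summable)

lemma weighted_norm_level_norm: "weighted_norm l S = (\<Sum>k. l ^ k * level_norm k S)"
  by (simp add: weighted_norm_def projective_norm_level)

lemma summable_weighted_norm_diff:
  assumes "rapidly_decaying S" "rapidly_decaying T" "l > 0"
  shows "summable (\<lambda>k. l ^ k * level_norm k (\<lambda>w. S w - T w))"
proof (rule summable_comparison_test'[where N = 0])
  show "summable (\<lambda>k. l ^ k * level_norm k S + l ^ k * level_norm k T)"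
    using assms by (intro summable_add) (auto simp: rapidly_decaying_def)
  show "norm (l ^ k * level_norm k (\<lambda>w. S w - T w)) \<le> l ^ k * level_norm k S + l ^ k * level_norm k T" for k
  proof -
    have "level_norm k (\<lambda>w. S w - T w) \<le> level_norm k S + level_norm k T"
      unfolding level_norm_def sum.distrib[symmetric] by (intro sum_mono) linarith
    then show ?thesis
      using assms(3) by (simp add: level_norm_nonneg distrib_left[symmetric])
  qed
qed

lemma weighted_norm_triangle:
  assumes "rapidly_decaying S" "rapidly_decaying T" "rapidly_decaying U" "l > 0"
  shows "weighted_norm l (\<lambda>w. S w - U w) \<le>
    weighted_norm l (\<lambda>w. S w - T w) + weighted_norm l (\<lambda>w. T w - U w)"
proof -
  note s = summable_weighted_norm_diff[OF assms(1,2,4)] summable_weighted_norm_diff[OF assms(2,3,4)]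
  have "weighted_norm l (\<lambda>w. S w - U w) \<le>
      (\<Sum>k. l ^ k * level_norm k (\<lambda>w. S w - T w) + l ^ k * level_norm k (\<lambda>w. T w - U w))"
    unfolding weighted_norm_level_norm
  proof (rule suminf_le)
    show "l ^ k * level_norm k (\<lambda>w. S w - U w) \<le>
        l ^ k * level_norm k (\<lambda>w. S w - T w) + l ^ k * level_norm k (\<lambda>w. T w - U w)" for k
      using level_norm_triangle[of k S U T] assms(4) by (simp add: distrib_left[symmetric])
  qed (intro summable_weighted_norm_diff summable_add assms)+
  then show ?thesis by (simp add: weighted_norm_level_norm suminf_add[OF s])
qed

lemma weighted_norm_mono:
  assumes "rapidly_decaying S" "rapidly_decaying T" "0 < l" "l \<le> m"
  shows "weighted_norm l (\<lambda>w. S w - T w) \<le> weighted_norm m (\<lambda>w. S w - T w)"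
  unfolding weighted_norm_level_norm using assms
  by (intro suminf_le summable_weighted_norm_diff mult_right_mono power_mono level_norm_nonneg) auto

lemma weighted_norm_diff_commute:
  "weighted_norm l (\<lambda>w. S w - T w) = weighted_norm l (\<lambda>w. T w - S w)"
  by (simp add: weighted_norm_level_norm level_norm_def abs_minus_commute)

text \<open>
Balls in \<open>group_like_fin\<close>; the centre need not be group-like.
\<close>

definition group_like_ball :: "'d::finite tensor_series \<Rightarrow> real \<Rightarrow> real \<Rightarrow> 'd tensor_series set" where
  "group_like_ball S l r = {T \<in> group_like_fin. weighted_norm l (\<lambda>w. T w - S w) < r}"

lemma group_like_open_contains_ball:
  assumes "openin group_like_fin_topology V" "T \<in> V"
  shows "T \<in> group_like_fin \<and> (\<exists>l>0. \<exists>r>0. group_like_ball T l r \<subseteq> V)"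
proof -
  have "generate_topology_on
     {{T \<in> group_like_fin. weighted_norm l (\<lambda>w. T w - S w) < r} | S l r.
        S \<in> group_like_fin \<and> l > 0 \<and> r > 0} V"
    using assms(1) unfolding group_like_fin_topology_def by (rule openin_topology_generated_by)
  then show ?thesis using assms(2)
  proof (induction arbitrary: T)
    case (Int V W)
    obtain l r where V: "T \<in> group_like_fin" "l > 0" "r > 0" "group_like_ball T l r \<subseteq> V"
      using Int by blast
    obtain m s where W: "m > 0" "s > 0" "group_like_ball T m s \<subseteq> W"
      using Int by blast
    have sub: "group_like_ball T (max l m) (min r s) \<subseteq> group_like_ball T l' r'"
      if "l' > 0" "l' \<le> max l m" "min r s \<le> r'" for l' r'
    proof
      fix U assume U: "U \<in> group_like_ball T (max l m) (min r s)"
      then have "weighted_norm l' (\<lambda>w. U w - T w) \<le> weighted_norm (max l m) (\<lambda>w. U w - T w)"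
        using V(1) that by (intro weighted_norm_mono group_like_fin_rapidly_decaying)
          (auto simp: group_like_ball_def)
      with U that show "U \<in> group_like_ball T l' r'" by (auto simp: group_like_ball_def)
    qed
    have "group_like_ball T (max l m) (min r s) \<subseteq> V \<inter> W"
      using sub[of l r] sub[of m s] V W by auto
    moreover have "max l m > 0" "min r s > 0" using V W by auto
    ultimately show ?case using V(1) by blast
  next
    case (UN K)
    then obtain k where "k \<in> K" "T \<in> k" by blast
    with UN.IH[of k T] show ?case by blast
  next
    case (Basis V)
    then obtain S l r where S: "S \<in> group_like_fin" "l > 0" "r > 0"
      and V: "V = {T \<in> group_like_fin. weighted_norm l (\<lambda>w. T w - S w) < r}" by blast
    have T: "T \<in> group_like_fin" "weighted_norm l (\<lambda>w. T w - S w) < r" using Basis V by auto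
    have "group_like_ball T l (r - weighted_norm l (\<lambda>w. T w - S w)) \<subseteq> V"
    proof
      fix U assume U: "U \<in> group_like_ball T l (r - weighted_norm l (\<lambda>w. T w - S w))"
      have "weighted_norm l (\<lambda>w. U w - S w) \<le>
          weighted_norm l (\<lambda>w. U w - T w) + weighted_norm l (\<lambda>w. T w - S w)"
        using U T S by (intro weighted_norm_triangle group_like_fin_rapidly_decaying)
          (auto simp: group_like_ball_def)
      with U show "U \<in> V" by (auto simp: V group_like_ball_def)
    qed
    then show ?case using S T by (intro conjI exI[of _ l] exI[of _ "r - weighted_norm l (\<lambda>w. T w - S w)"]) auto
  qed simp
qed

text \<open>
The finitely supported tensor series with rational coefficients, coded by association lists so as
to be manifestly countable.
\<close>

definition rational_tensor :: "('d::finite list \<times> rat) list \<Rightarrow> 'd tensor_series" where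
  "rational_tensor xs = (\<lambda>w. case map_of xs w of None \<Rightarrow> 0 | Some q \<Rightarrow> of_rat q)"

lemma rapidly_decaying_rational_tensor: "rapidly_decaying (rational_tensor xs)"
  unfolding rapidly_decaying_def
proof (intro allI impI)
  fix l :: real assume "l > 0"
  define N where "N = length ` fst ` set xs"
  show "summable (\<lambda>k. l ^ k * level_norm k (rational_tensor xs))"
  proof (rule summable_finite[of N])
    fix k assume "k \<notin> N"
    have "rational_tensor xs w = 0" if "w \<in> words k" for w
    proof -
      have "w \<notin> fst ` set xs" using that \<open>k \<notin> N\<close> by (auto simp: N_def words_iff)
      then have "map_of xs w = None" by (simp add: map_of_eq_None_iff)
      then show ?thesis by (simp add: rational_tensor_def)
    qed
    then show "l ^ k * level_norm k (rational_tensor xs) = 0" by (simp add: level_norm_def)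
  qed (simp add: N_def)
qed

lemma rational_tensor_dense:
  fixes T :: "'d::finite tensor_series"
  assumes T: "rapidly_decaying T" and l: "l > 0" and e: "e > 0"
  shows "\<exists>xs. weighted_norm l (\<lambda>w. T w - rational_tensor xs w) < e"
proof -
  have sT: "summable (\<lambda>k. l ^ k * level_norm k T)" using T l by (simp add: rapidly_decaying_def)
  have "(\<lambda>K. (\<Sum>k. l ^ (k + K) * level_norm (k + K) T)) \<longlonglongrightarrow> 0"
    using suminf_exist_split2[OF sT] by simp
  then have "eventually (\<lambda>K. (\<Sum>k. l ^ (k + K) * level_norm (k + K) T) < e / 2) sequentially"
    using e by (intro order_tendstoD) auto
  then obtain K where K: "(\<Sum>k. l ^ (k + K) * level_norm (k + K) T) < e / 2"
    by (auto simp: eventually_sequentially)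
  define c where "c = (\<Sum>k<K. l ^ k * real (CARD('d)) ^ k)"
  have c: "c \<ge> 0" using l by (simp add: c_def sum_nonneg)
  define d where "d = e / (2 * (c + 1))"
  have d: "d > 0" using e c by (simp add: d_def)
  have "\<exists>q. \<bar>T w - of_rat q\<bar> < d" for w
    using of_rat_dense[of "T w - d" "T w + d"] d by (auto simp: abs_less_iff) (metis add.commute diff_less_eq less_diff_eq)
  then obtain q where q: "\<And>w. \<bar>T w - of_rat (q w)\<bar> < d" by metis
  define W where "W = {w :: 'd list. length w < K}"
  have "finite W"
    by (rule finite_subset[OF _ finite_lists_length_le[of "UNIV :: 'd set" K]]) (auto simp: W_def)
  then obtain ws where ws: "set ws = W" using finite_list by blast
  define R where "R = rational_tensor (map (\<lambda>w. (w, q w)) ws)"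
  have R: "R w = (if length w < K then of_rat (q w) else 0)" for w
    by (auto simp: R_def rational_tensor_def map_of_map_restrict ws W_def restrict_map_def)
  have rR: "rapidly_decaying R" unfolding R_def by (rule rapidly_decaying_rational_tensor)
  have low: "level_norm k (\<lambda>w. T w - R w) \<le> real (CARD('d)) ^ k * d" if "k < K" for k
  proof -
    have "\<bar>T w - R w\<bar> \<le> d" if "w \<in> words k" for w
      using q[of w] that \<open>k < K\<close> by (simp add: R words_iff)
    then show ?thesis
      using sum_bounded_above[of "words k :: 'd list set" "\<lambda>w. \<bar>T w - R w\<bar>" d]
      by (simp add: level_norm_def card_words)
  qed
  have high: "level_norm (k + K) (\<lambda>w. T w - R w) = level_norm (k + K) T" for k
    unfolding level_norm_def by (intro sum.cong) (auto simp: R words_iff)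
  have "weighted_norm l (\<lambda>w. T w - R w) =
      (\<Sum>k. l ^ (k + K) * level_norm (k + K) (\<lambda>w. T w - R w)) +
      (\<Sum>k<K. l ^ k * level_norm k (\<lambda>w. T w - R w))"
    unfolding weighted_norm_level_norm
    by (rule suminf_split_initial_segment[OF summable_weighted_norm_diff[OF T rR l]])
  also have "\<dots> < e / 2 + e / 2"
  proof (rule add_less_le_mono)
    show "(\<Sum>k. l ^ (k + K) * level_norm (k + K) (\<lambda>w. T w - R w)) < e / 2"
      using K by (simp add: high)
    have "(\<Sum>k<K. l ^ k * level_norm k (\<lambda>w. T w - R w)) \<le> (\<Sum>k<K. l ^ k * (real (CARD('d)) ^ k * d))"
      using low l by (intro sum_mono mult_left_mono) auto
    also have "\<dots> = c * d" by (simp add: c_def sum_distrib_left mult_ac)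
    also have "\<dots> \<le> e / 2" using c e by (simp add: d_def field_simps)
    finally show "(\<Sum>k<K. l ^ k * level_norm k (\<lambda>w. T w - R w)) \<le> e / 2" .
  qed
  finally show ?thesis by (auto simp: R_def)
qed

text \<open>
Second countability: the countably many balls around rational tensor series, with rational radius and
integral weight, suffice to exhaust every open set.
\<close>

lemma group_like_open_eq_Union_rational_balls:
  assumes V: "openin group_like_fin_topology V"
  shows "V = (\<Union>(xs, n, q) \<in> {(xs, n, q). group_like_ball (rational_tensor xs) (real (Suc n)) (of_rat q) \<subseteq> V}.
      group_like_ball (rational_tensor xs) (real (Suc n)) (of_rat q))" (is "V = ?U")
proof
  show "V \<subseteq> ?U"
  proof
    fix T assume "T \<in> V"
    then obtain l r where T: "T \<in> group_like_fin" "l > 0" "r > 0" "group_like_ball T l r \<subseteq> V"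
      using group_like_open_contains_ball[OF V] by blast
    obtain n where n: "l \<le> real n" using real_arch_simple by blast
    then have ln: "l \<le> real (Suc n)" by simp
    note dT = group_like_fin_rapidly_decaying[OF T(1)]
    obtain q where q: "0 < (of_rat q :: real)" "of_rat q < r / 2"
      using of_rat_dense[of 0 "r / 2"] T(3) by auto
    obtain xs where xs: "weighted_norm (real (Suc n)) (\<lambda>w. T w - rational_tensor xs w) < of_rat q"
      using rational_tensor_dense[OF dT _ q(1), of "real (Suc n)"] by auto
    have "group_like_ball (rational_tensor xs) (real (Suc n)) (of_rat q) \<subseteq> group_like_ball T l r"
    proof
      fix U assume U: "U \<in> group_like_ball (rational_tensor xs) (real (Suc n)) (of_rat q)"
      then have dU: "rapidly_decaying U" by (auto simp: group_like_ball_def group_like_fin_rapidly_decaying)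
      have "weighted_norm l (\<lambda>w. U w - T w) \<le> weighted_norm (real (Suc n)) (\<lambda>w. U w - T w)"
        using dU dT T(2) ln by (rule weighted_norm_mono)
      also have "\<dots> \<le> weighted_norm (real (Suc n)) (\<lambda>w. U w - rational_tensor xs w) +
          weighted_norm (real (Suc n)) (\<lambda>w. rational_tensor xs w - T w)"
        by (rule weighted_norm_triangle[OF dU rapidly_decaying_rational_tensor dT]) simp
      also have "\<dots> < r"
        using U xs q(2) weighted_norm_diff_commute[of "real (Suc n)" T "rational_tensor xs"]
        by (simp add: group_like_ball_def)
      finally show "U \<in> group_like_ball T l r" using U by (simp add: group_like_ball_def)
    qed
    moreover have "T \<in> group_like_ball (rational_tensor xs) (real (Suc n)) (of_rat q)"
      using T(1) xs by (simp add: group_like_ball_def)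
    ultimately show "T \<in> ?U" using T(4) by blast
  qed
qed auto

text \<open>
The Borel sigma-algebra is generated by the coordinates, since weighted distances from a fixed
series are measurable functions of them.
\<close>

lemma sets_group_like_fin_borel_subset:
  fixes N :: "'d::finite tensor_series measure"
  assumes space: "space N = group_like_fin"
    and coord [measurable]: "\<And>w. (\<lambda>S. S w) \<in> borel_measurable N"
  shows "sets group_like_fin_borel \<subseteq> sets N"
proof -
  have ball: "group_like_ball R l r \<in> sets N" for R l r
  proof -
    have "{T \<in> space N. (\<Sum>k. l ^ k * (\<Sum>w\<in>words k. \<bar>T w - R w\<bar>)) < r} \<in> sets N"
      by measurable
    then show ?thesis by (simp add: group_like_ball_def weighted_norm_level_norm level_norm_def space)
  qed
  have "V \<in> sets N" if "openin group_like_fin_topology V" for V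
    by (subst group_like_open_eq_Union_rational_balls[OF that])
       (intro sets.countable_UN', auto intro: ball)
  then have "sigma_sets (space N) {V. openin group_like_fin_topology V} \<subseteq> sets N"
    by (intro sets.sigma_sets_subset) auto
  moreover have "{V. openin group_like_fin_topology V} \<subseteq> Pow (space N)"
    using group_like_open_contains_ball space by blast
  ultimately show ?thesis
    unfolding group_like_fin_borel_def space[symmetric] by (simp only: sets_measure_of)
qed

section \<open>Density\<close>

context convergent_expected_signature
begin

lemma approximable_zigzag_coordinate:
  assumes t: "t > 0"
  shows "approximable (zigzag_coordinate w 0 t)"
proof -
  have "approximable (\<lambda>S. \<Sum>j. \<Sum>v\<in>words j. (t ^ length v * zigzag w v 0) * S v)"
  proof (rule approximable_word_series)
    show "2 * t > 0" using t by simp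
    show "\<bar>t ^ length v * zigzag w v 0\<bar> \<le> (2 * t) ^ length v" for v
      using mult_left_mono[OF abs_zigzag_le[of w v 0], of "t ^ length v"] t
      by (simp add: abs_mult power_mult_distrib mult.commute)
    show "\<bar>\<Sum>j. \<Sum>v\<in>words j. (t ^ length v * zigzag w v 0) * S v\<bar> \<le> 1" if "S \<in> group_like_fin" for S
      using abs_zigzag_coordinate_le[OF that, of w t] by (simp add: zigzag_coordinate_def)
  qed
  then show ?thesis by (simp add: zigzag_coordinate_def[abs_def])
qed

lemma coordinate_measurable_approximable_algebra:
  "(\<lambda>S. S w) \<in> borel_measurable approximable_algebra"
proof (rule borel_measurable_LIMSEQ_real)
  show "(\<lambda>n. real (Suc n) ^ length w * zigzag_coordinate w 0 (1 / real (Suc n)) S) \<longlonglongrightarrow> S w"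
    if "S \<in> space approximable_algebra" for S
    using that by (intro zigzag_coordinate_limit) (simp add: space_approximable_algebra space_M)
  show "(\<lambda>S. real (Suc n) ^ length w * zigzag_coordinate w 0 (1 / real (Suc n)) S)
      \<in> borel_measurable approximable_algebra" for n
    by (intro borel_measurable_times borel_measurable_const approximable_measurable
        approximable_zigzag_coordinate) simp
qed

lemma sets_M_subset_approximable_algebra: "sets M \<subseteq> sets approximable_algebra"
  unfolding sets_M
  by (rule sets_group_like_fin_borel_subset)
     (auto simp: space_approximable_algebra space_M coordinate_measurable_approximable_algebra)

lemma linear_coordinate_functions_subset: "linear_coordinate_functions \<subseteq> coordinate_span"
  by (auto simp: coordinate_span_def)

lemma dense_in_Lp_linear_coordinate_functions:
  assumes p: "p \<ge> 1"
  shows "dense_in_Lp p M linear_coordinate_functions"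
  unfolding dense_in_Lp_def
proof (intro conjI subsetI ballI allI impI)
  fix g :: "'d tensor_series \<Rightarrow> real" assume "g \<in> linear_coordinate_functions"
  then have g: "g \<in> coordinate_span" using linear_coordinate_functions_subset by blast
  show "g \<in> Lp_space p M"
    using g p by (simp add: Lp_space_def measurable_mem integrable_powr_mem)
next
  fix f and e :: real assume f: "f \<in> Lp_space p M" and e: "e > 0"
  then have "f \<in> borel_measurable M" "integrable M (\<lambda>S. \<bar>f S\<bar> powr p)" "e powr p > 0"
    by (auto simp: Lp_space_def)
  then obtain g where g: "g \<in> coordinate_span" "(LINT S|M. \<bar>f S - g S\<bar> powr p) < e powr p"
    using dense_powr[OF sets_M_subset_approximable_algebra p] by blast
  obtain h where h: "h \<in> linear_coordinate_functions" "\<And>S. S \<in> group_like_fin \<Longrightarrow> g S = h S"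
    using g(1) by (auto simp: coordinate_span_def)
  have "(LINT S|M. \<bar>f S - h S\<bar> powr p) = (LINT S|M. \<bar>f S - g S\<bar> powr p)"
    by (rule Bochner_Integration.integral_cong) (auto simp: space_M h(2))
  with g(2) have "(LINT S|M. \<bar>f S - h S\<bar> powr p) < e powr p" by simp
  then have "Lp_norm p M (\<lambda>S. f S - h S) < (e powr p) powr (1 / p)"
    unfolding Lp_norm_def using p
    by (intro powr_less_mono2) (auto intro!: Bochner_Integration.integral_nonneg)
  also have "\<dots> = e" using e p by (simp add: powr_powr)
  finally show "\<exists>h\<in>linear_coordinate_functions. Lp_norm p M (\<lambda>S. f S - h S) < e" using h(1) by blast
qed

end

theorem theorem2p4:
  fixes M :: "'d::finite tensor_series measure"
  assumes "prob_space M"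
    and "sets M = sets group_like_fin_borel"
    and "integrable_levels M"
    and "infinite_radius_of_convergence M"
  shows "\<forall>p::real. p \<ge> 1 \<longrightarrow> dense_in_Lp p M linear_coordinate_functions"
proof -
  interpret prob_space M by (rule assms(1))
  interpret convergent_expected_signature M
    by unfold_locales (rule assms)+
  show ?thesis using dense_in_Lp_linear_coordinate_functions by blast
qed

end
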